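(* Let $\alpha,\lambda\in(0,\infty)$ and $\beta\in(0,1)$, and let $g$ be the (continuous) density of the one-sided tempered stable distribution $\eta=\mathrm{TS}(\alpha,\beta,\lambda)$. Then $$\ln g(x)\sim-\frac{1-\beta}{\beta}\,(\alpha\,\Gamma(1-\beta))^{\frac1{1-\beta}}\,x^{-\frac\beta{1-\beta}}\quad\text{as }x\downarrow0.$$ In particular, $g(x)\to0$ as $x\downarrow0$.
   Context: For $\alpha,\lambda\in(0,\infty)$ and $\beta\in[0,1)$, the one-sided tempered stable distribution $\mathrm{TS}(\alpha,\beta,\lambda)$ is the infinitely divisible distribution on $\mathbb{R}$ with characteristic function $\varphi(z)=\exp\big(\int_{\mathbb{R}}(e^{izx}-1)F(dx)\big)$, $z\in\mathbb{R}$, where $F(dx)=\frac{\alpha}{x^{1+\beta}}e^{-\lambda x}\mathbf{1}_{(0,\infty)}(x)\,dx$. For $\beta\in(0,1)$ it is absolutely continuous with a density $g$ of class $C^\infty(\mathbb{R})$. The notation $a(x)\sim b(x)$ means that $a(x)/b(x)\to1$ in the indicated limit. $\Gamma$ is the Gamma function. *)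

theory Defs
  imports "HOL-Probability.Probability" "HOL-Library.Landau_Symbols"
begin

definition TS_levy_measure :: "real \<Rightarrow> real \<Rightarrow> real \<Rightarrow> real measure" where
  "TS_levy_measure \<alpha> \<beta> lam =
     density lborel
       (\<lambda>x. ennreal (\<alpha> / x powr (1 + \<beta>) * exp (- lam * x) * indicator {0<..} x))"

text \<open>A probability distribution on the reals is determined by its characteristic function, so for
  given parameters at most one measure satisfies the following predicate. Infinite divisibility is
  not listed separately: it is a consequence of the form of the characteristic function.\<close>

definition is_TS :: "real \<Rightarrow> real \<Rightarrow> real \<Rightarrow> real measure \<Rightarrow> bool" where
  "is_TS \<alpha> \<beta> lam \<eta> \<longleftrightarrow>
     real_distribution \<eta> \<and>
     (\<forall>z. char \<eta> z = exp (\<integral>x. (iexp (z * x) - 1) \<partial>TS_levy_measure \<alpha> \<beta> lam))"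

text \<open>The pointwise sign condition is needed because \<^const>\<open>ennreal\<close> truncates negative values.\<close>

definition is_continuous_density :: "real measure \<Rightarrow> (real \<Rightarrow> real) \<Rightarrow> bool" where
  "is_continuous_density \<eta> g \<longleftrightarrow>
     continuous_on UNIV g \<and> (\<forall>x. 0 \<le> g x) \<and> \<eta> = density lborel (\<lambda>x. ennreal (g x))"

end

theory Submission
  imports Defs "HOL-Real_Asymp.Real_Asymp"
begin

text \<open>Write k(y) = \<alpha> y^(-\<beta>) e^(-\<lambda>y) and let G be the distribution function. The characteristic function
  forces a second moment, and differentiating it gives the convolution equation x g(x) = (g * k)(x).
  Integrating this equation against e^(-sx) yields L' = - L K with K(s) = \<alpha> \<Gamma>(1-\<beta>) (\<lambda>+s)^(\<beta>-1), hence
  the Laplace transform L and the mean and variance of the exponentially tilted laws. Chernoff's bound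
  from above and Chebyshev's inequality under tilting from below give the logarithmic asymptotics of G.
  The convolution equation transfers them to g without any complex analysis: as k decreases,
  x g(x) \<ge> k(x) G(x), and splitting the convolution at a small \<epsilon> gives t g(t) \<le> t (max g) / 2 + k(\<epsilon>) G(t)
  for t \<le> x, which at a maximum point t of g on [0,x] bounds g(x) by G(t) times a power of t.\<close>

section \<open>Integrals and characteristic functions\<close>

text \<open>The definition supplies only the characteristic function on the real axis, so no moment,
  no support and no Laplace transform of \<eta> is given. Differentiating \<open>char \<eta>\<close>
  under the integral needs a first moment, hence the detour through a second one. Multiplication by
  x turns the infinite Levy measure into the finite measure \<open>\<kappa>\<close>, so the equation
  for g involves an ordinary convolution with an integrable kernel. The limiting constant is a
  Legendre transform: with p = lam + s, Chernoff's exponent is p x - (A / \<beta>) p^\<beta> up to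
  bounded terms, and it is minimal where A p^(\<beta>-1) = x. The tilted laws have relative variance
  of order p^(-\<beta>), which tends to 0, so Chebyshev's inequality already yields a matching lower
  bound. No monotonicity of g near 0 is available to pass from G to g; the passage used here costs
  powers of the argument, which are negligible on the logarithmic scale.\<close>

text \<open>Dominated convergence along sequences: the Lipschitz bound \<open>w\<close> dominates
  the difference quotients. The set \<open>S\<close> allows the one-sided derivative of the Laplace
  transform at 0.\<close>

lemma has_vector_derivative_integral:
  fixes f :: "real \<Rightarrow> 'a \<Rightarrow> 'b::{banach, second_countable_topology}"
  assumes int: "\<And>s. s \<in> S \<Longrightarrow> integrable M (f s)"
    and w: "integrable M w"
    and f': "integrable M f'"
    and t: "t \<in> S"
    and lip: "\<And>s. s \<in> S \<Longrightarrow> AE x in M. norm (f s x - f t x) \<le> \<bar>s - t\<bar> * w x"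
    and deriv: "AE x in M. ((\<lambda>s. f s x) has_vector_derivative f' x) (at t within S)"
  shows "((\<lambda>s. \<integral>x. f s x \<partial>M) has_vector_derivative (\<integral>x. f' x \<partial>M)) (at t within S)"
  unfolding has_vector_derivative_def has_derivative_within tendsto_at_iff_sequentially comp_def
proof (intro conjI allI impI bounded_linear_scaleR_left)
  fix X :: "nat \<Rightarrow> real"
  assume X: "\<forall>i. X i \<in> S - {t}" "X \<longlonglongrightarrow> t"
  define D where "D i x = (1 / norm (X i - t)) *\<^sub>R (f (X i) x - (f t x + (X i - t) *\<^sub>R f' x))" for i x
  have intD: "integrable M (D i)" for i
    unfolding D_def using X t by (intro integrable_scaleR_right Bochner_Integration.integrable_diff
      Bochner_Integration.integrable_add int f') auto
  have "(\<lambda>i. \<integral>x. D i x \<partial>M) \<longlonglongrightarrow> (\<integral>x. 0 \<partial>M)"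
  proof (rule integral_dominated_convergence)
    show "integrable M (\<lambda>x. w x + norm (f' x))" using w f' by auto
    show "AE x in M. (\<lambda>i. D i x) \<longlonglongrightarrow> 0"
      using deriv
    proof eventually_elim
      case (elim x)
      then show ?case
        using X unfolding has_vector_derivative_def has_derivative_within tendsto_at_iff_sequentially
          comp_def D_def by blast
    qed
    fix i
    have Xi: "X i \<in> S" "X i \<noteq> t" using X by auto
    show "AE x in M. norm (D i x) \<le> w x + norm (f' x)"
      using lip[OF Xi(1)]
    proof eventually_elim
      case (elim x)
      have "norm (f (X i) x - (f t x + (X i - t) *\<^sub>R f' x))
          \<le> norm (f (X i) x - f t x) + norm ((X i - t) *\<^sub>R f' x)"
        by (metis diff_diff_add norm_triangle_ineq4)
      also have "\<dots> \<le> \<bar>X i - t\<bar> * (w x + norm (f' x))"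
        using elim by (simp add: distrib_left)
      finally show ?case
        using Xi by (simp add: D_def divide_simps mult.commute)
    qed
  qed (use intD in auto)
  moreover have "(\<integral>x. D i x \<partial>M) = (1 / norm (X i - t)) *\<^sub>R
    ((\<integral>x. f (X i) x \<partial>M) - ((\<integral>x. f t x \<partial>M) + (X i - t) *\<^sub>R (\<integral>x. f' x \<partial>M)))" for i
    unfolding D_def using X t int[of t] int[of "X i"] f' by simp
  ultimately show "(\<lambda>i. (1 / norm (X i - t)) *\<^sub>R
    ((\<integral>x. f (X i) x \<partial>M) - ((\<integral>x. f t x \<partial>M) + (X i - t) *\<^sub>R (\<integral>x. f' x \<partial>M)))) \<longlonglongrightarrow> 0"
    by simp
qed

text \<open>Uniqueness for signed densities, needed because \<open>x * g x\<close> may change sign a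
  priori. Positive and negative part have equal mass (take z = 0), so after normalisation Levy's
  uniqueness theorem for probability laws applies.\<close>

lemma integrable_char_zero_imp_AE_zero:
  fixes h :: "real \<Rightarrow> real"
  assumes h: "integrable lborel h"
    and zero: "\<And>z. (\<integral>x. iexp (z * x) * of_real (h x) \<partial>lborel) = (0::complex)"
  shows "AE x in lborel. h x = 0"
proof -
  have [measurable]: "h \<in> borel_measurable borel" using h by auto
  define p q where "p x = max 0 (h x)" and "q x = max 0 (- h x)" for x
  have [measurable]: "p \<in> borel_measurable borel" "q \<in> borel_measurable borel"
    unfolding p_def q_def by measurable
  have pq: "h x = p x - q x" "0 \<le> p x" "0 \<le> q x" for x by (auto simp: p_def q_def)
  have ip: "integrable lborel p" and iq: "integrable lborel q"
    using h unfolding p_def q_def by auto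
  have ie: "integrable lborel (\<lambda>x. iexp (z * x) * of_real (f x) :: complex)"
    if "integrable lborel f" for f :: "real \<Rightarrow> real" and z
    by (rule Bochner_Integration.integrable_bound[OF that]) (use that in \<open>auto simp: norm_mult\<close>)
  have eq: "(\<integral>x. iexp (z * x) * of_real (p x) \<partial>lborel) = (\<integral>x. iexp (z * x) * of_real (q x) \<partial>lborel)" for z
    using zero[of z] ie[OF ip, of z] ie[OF iq, of z]
    by (simp add: pq(1) right_diff_distrib)
  define c where "c = (\<integral>x. p x \<partial>lborel)"
  have "complex_of_real (\<integral>x. p x \<partial>lborel) = complex_of_real (\<integral>x. q x \<partial>lborel)"
    using eq[of 0] by (simp only: integral_complex_of_real[symmetric]) simp
  then have cq: "c = (\<integral>x. q x \<partial>lborel)" by (simp add: c_def)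
  show ?thesis
  proof (cases "c = 0")
    case True
    have "AE x in lborel. p x = 0"
      using True ip pq by (subst integral_nonneg_eq_0_iff_AE[symmetric]) (auto simp: c_def)
    moreover have "AE x in lborel. q x = 0"
      using True iq pq cq by (subst integral_nonneg_eq_0_iff_AE[symmetric]) auto
    ultimately show ?thesis by eventually_elim (simp add: pq)
  next
    case False
    have "0 \<le> c" unfolding c_def using pq by (intro Bochner_Integration.integral_nonneg) auto
    with False have c: "0 < c" by simp
    have real_dist: "real_distribution (density lborel (\<lambda>x. ennreal (f x / c)))"
      if f: "integrable lborel f" "\<And>x. 0 \<le> f x" "(\<integral>x. f x \<partial>lborel) = c" for f
    proof -
      have "(\<integral>\<^sup>+x. ennreal (f x / c) \<partial>lborel) = ennreal (\<integral>x. f x / c \<partial>lborel)"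
        using f c by (intro nn_integral_eq_integral) auto
      also have "\<dots> = 1" using f c by simp
      finally have "prob_space (density lborel (\<lambda>x. ennreal (f x / c)))"
        using f by (intro prob_spaceI) (auto simp: emeasure_density)
      then show ?thesis
        by (simp add: real_distribution_def real_distribution_axioms_def)
    qed
    have char: "char (density lborel (\<lambda>x. ennreal (f x / c))) z
      = (\<integral>x. iexp (z * x) * of_real (f x) \<partial>lborel) / c"
      if f: "integrable lborel f" "\<And>x. 0 \<le> f x" for f z
    proof -
      have [measurable]: "f \<in> borel_measurable borel" using f by auto
      have "char (density lborel (\<lambda>x. ennreal (f x / c))) z =
        (\<integral>x. (f x / c) *\<^sub>R iexp (z * x) \<partial>lborel)"
        unfolding char_def using f c by (subst integral_density) auto
      also have "\<dots> = (\<integral>x. iexp (z * x) * of_real (f x) / c \<partial>lborel)"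
        by (simp add: scaleR_conv_of_real mult.commute)
      finally show ?thesis by simp
    qed
    have "density lborel (\<lambda>x. ennreal (p x / c)) = density lborel (\<lambda>x. ennreal (q x / c))"
      by (intro Levy_uniqueness real_dist ip iq pq ext)
        (use char[OF ip] char[OF iq] pq eq cq c_def in auto)
    then have "AE x in lborel. ennreal (p x / c) = ennreal (q x / c)"
      by (intro sigma_finite_measure.density_unique[OF sigma_finite_lborel]) auto
    then show ?thesis by eventually_elim (use c pq in simp)
  qed
qed

text \<open>The set where the inequality fails is open and null, and a nonempty open set is not
  null. This upgrades statements about densities from almost everywhere to everywhere.\<close>

lemma AE_lborel_le_continuous:
  fixes f g :: "real \<Rightarrow> real"
  assumes S: "open S" and f: "continuous_on S f" and g: "continuous_on S g"
    and ae: "AE x in lborel. x \<in> S \<longrightarrow> f x \<le> g x" and x: "x \<in> S"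
  shows "f x \<le> g x"
proof (rule ccontr)
  assume *: "\<not> f x \<le> g x"
  define U where "U = {x\<in>S. 0 < f x - g x}"
  have "open U"
  proof -
    have "U = S \<inter> (\<lambda>x. f x - g x) -` {0<..}" by (auto simp: U_def)
    then show ?thesis
      using f g S by (metis continuous_on_diff continuous_on_open_vimage open_greaterThan Int_commute)
  qed
  moreover have "AE x in lborel. x \<notin> U" using ae by eventually_elim (auto simp: U_def)
  then have "U \<in> null_sets lborel"
    using \<open>open U\<close> by (subst (asm) AE_iff_null_sets[symmetric]) auto
  then have "negligible U"
    by (simp add: null_sets_completionI negligible_iff_null_sets)
  ultimately have "U = {}" using open_not_negligible by blast
  then show False using * x by (auto simp: U_def)
qed

lemma nn_integral_powr_exp:
  fixes c p :: real
  assumes c: "0 < c" and p: "0 < p"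
  shows "(\<integral>\<^sup>+y. ennreal (y powr (c - 1) * exp (- p * y) * indicator {0<..} y) \<partial>lborel)
    = ennreal (Gamma c / p powr c)"
proof -
  have "ennreal (Gamma c) = (\<integral>\<^sup>+t. ennreal (indicator {0..} t * t powr (c - 1) / exp t) \<partial>lborel)"
    by (rule Gamma_conv_nn_integral_real[OF c])
  also have "\<dots> = ennreal \<bar>p\<bar> * (\<integral>\<^sup>+y. ennreal (indicator {0..} (0 + p * y) * (0 + p * y) powr (c - 1) / exp (0 + p * y)) \<partial>lborel)"
    using p by (intro nn_integral_real_affine) auto
  also have "(\<integral>\<^sup>+y. ennreal (indicator {0..} (0 + p * y) * (0 + p * y) powr (c - 1) / exp (0 + p * y)) \<partial>lborel)
    = (\<integral>\<^sup>+y. ennreal (p powr (c - 1)) * ennreal (y powr (c - 1) * exp (- p * y) * indicator {0<..} y) \<partial>lborel)"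
    using p by (intro nn_integral_cong)
      (auto simp: ennreal_mult'[symmetric] indicator_def powr_mult exp_minus field_simps zero_le_mult_iff not_le)
  also have "\<dots> = ennreal (p powr (c - 1)) * (\<integral>\<^sup>+y. ennreal (y powr (c - 1) * exp (- p * y) * indicator {0<..} y) \<partial>lborel)"
    by (intro nn_integral_cmult) auto
  finally have "ennreal (Gamma c) = ennreal (p powr c) * (\<integral>\<^sup>+y. ennreal (y powr (c - 1) * exp (- p * y) * indicator {0<..} y) \<partial>lborel)"
    using p by (simp add: mult.assoc[symmetric] ennreal_mult'[symmetric] powr_diff)
  then have "ennreal (1 / p powr c) * ennreal (Gamma c) = (ennreal (1 / p powr c) * ennreal (p powr c)) * (\<integral>\<^sup>+y. ennreal (y powr (c - 1) * exp (- p * y) * indicator {0<..} y) \<partial>lborel)"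
    by (simp add: mult.assoc)
  moreover have "ennreal (1 / p powr c) * ennreal (p powr c) = 1"
    using p by (simp add: ennreal_mult'[symmetric])
  moreover have "ennreal (1 / p powr c) * ennreal (Gamma c) = ennreal (Gamma c / p powr c)"
    using p by (simp add: ennreal_mult'[symmetric])
  ultimately show ?thesis by simp
qed

section \<open>Estimates for characteristic functions and moments\<close>

lemma norm_iexp_diff_le: "norm (iexp s - iexp t) \<le> \<bar>s - t\<bar>"
proof -
  have "iexp s - iexp t = iexp t * (iexp (s - t) - 1)"
    by (simp add: right_diff_distrib exp_add[symmetric])
  then have "norm (iexp s - iexp t) = norm (iexp (s - t) - 1)"
    by (simp add: norm_mult)
  then show ?thesis using iexp_approx1[of "s - t" 0] by simp
qed

lemma one_minus_cos_le: "1 - cos (x::real) \<le> x\<^sup>2 / 2"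
proof -
  have "\<bar>sin (x / 2)\<bar> \<le> \<bar>x / 2\<bar>" by (rule abs_sin_x_le_abs_x)
  then have "(sin (x / 2))\<^sup>2 \<le> (x / 2)\<^sup>2" by (simp only: abs_le_square_iff)
  then show ?thesis using cos_double_sin[of "x / 2"] by (simp add: power_divide)
qed

text \<open>Finiteness of M is not assumed: subtracting 1 makes the integrand O(|x|), so the lemma
  serves the infinite Levy measure as well as \<eta>.\<close>

lemma char_has_vector_derivative:
  fixes M :: "real measure"
  assumes [measurable_cong]: "sets M = sets borel" and x: "integrable M (\<lambda>x. x)"
  shows "((\<lambda>z. \<integral>x. (iexp (z * x) - 1) \<partial>M) has_vector_derivative
    \<i> * (\<integral>x. of_real x * iexp (z * x) \<partial>M)) (at z)"
proof -
  have norm: "norm (iexp (s * x) - iexp (t * x)) \<le> \<bar>s - t\<bar> * \<bar>x\<bar>" for s t x :: real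
    using norm_iexp_diff_le[of "s * x" "t * x"] by (simp add: left_diff_distrib[symmetric] abs_mult)
  have "((\<lambda>z. \<integral>x. (iexp (z * x) - 1) \<partial>M) has_vector_derivative
    (\<integral>x. \<i> * of_real x * iexp (z * x) \<partial>M)) (at z within UNIV)"
  proof (rule has_vector_derivative_integral)
    show "integrable M (\<lambda>x. \<bar>x\<bar>)" using x by auto
    show "integrable M (\<lambda>x. iexp (s * x) - 1)" for s
      by (rule Bochner_Integration.integrable_bound[OF integrable_mult_right[OF x, of s]])
        (use norm[of s _ 0] in \<open>auto simp: abs_mult\<close>)
    show "integrable M (\<lambda>x. \<i> * of_real x * iexp (z * x))"
      by (rule Bochner_Integration.integrable_bound[OF x]) (auto simp: norm_mult)
    show "AE x in M. norm (iexp (s * x) - 1 - (iexp (z * x) - 1)) \<le> \<bar>s - z\<bar> * \<bar>x\<bar>" for s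
      using norm by simp
    have "((\<lambda>s. iexp (s * x) - 1) has_vector_derivative \<i> * of_real x * iexp (z * x)) (at z)" for x
    proof -
      have "((iexp \<circ> (\<lambda>s. s * x)) has_vector_derivative x *\<^sub>R (\<i> * iexp (z * x))) (at z)"
        by (rule vector_diff_chain_at) (auto intro!: derivative_eq_intros has_vector_derivative_iexp)
      then show ?thesis
        by (auto simp: o_def scaleR_conv_of_real algebra_simps intro!: derivative_eq_intros)
    qed
    then show "AE x in M. ((\<lambda>s. iexp (s * x) - 1) has_vector_derivative \<i> * of_real x * iexp (z * x)) (at z within UNIV)"
      by simp
  qed simp
  then show ?thesis by (simp add: mult.assoc)
qed

text \<open>Fatou's lemma along \<open>2 (1 - cos (h X)) / h\<^sup>2 \<longlonglongrightarrow> X\<^sup>2\<close>.\<close>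

lemma (in real_distribution) integrable_square_of_char:
  assumes bound: "\<And>h. 1 - Re (char M h) \<le> A * h\<^sup>2"
  shows "integrable M (\<lambda>x. x\<^sup>2)"
proof -
  define u where "u n x = 2 * (1 - cos (x / Suc n)) * (Suc n)\<^sup>2" for n :: nat and x :: real
  have [measurable]: "u n \<in> borel_measurable borel" for n unfolding u_def by measurable
  have lim: "(\<lambda>n. u n x) \<longlonglongrightarrow> x\<^sup>2" for x
    unfolding u_def of_nat_Suc by (real_asymp simp: power2_eq_square)
  have u: "(\<integral>\<^sup>+x. ennreal (u n x) \<partial>M) \<le> ennreal (2 * A)" for n
  proof -
    have "(\<integral>\<^sup>+x. ennreal (u n x) \<partial>M) = ennreal (\<integral>x. u n x \<partial>M)"
      by (intro nn_integral_eq_integral integrable_const_bound[where B="4 * (Suc n)\<^sup>2"])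
        (auto simp: u_def abs_mult intro!: mult_right_mono AE_I2 abs_leI, smt (verit) cos_ge_minus_one cos_le_one)
    also have "(\<integral>x. u n x \<partial>M) = 2 * (Suc n)\<^sup>2 * (1 - Re (char M (1 / Suc n)))"
    proof -
      have ic: "integrable M (\<lambda>x. cos (x / Suc n))"
        by (intro integrable_const_bound[where B=1]) auto
      have "Re (char M (1 / Suc n)) = (\<integral>x. Re (iexp (1 / Suc n * x)) \<partial>M)"
        unfolding char_def by (intro integral_Re[symmetric] integrable_iexp) auto
      also have "\<dots> = (\<integral>x. cos (x / Suc n) \<partial>M)" by (simp add: Re_exp)
      finally show ?thesis
        unfolding u_def using ic prob_space by simp
    qed
    also have "\<dots> \<le> 2 * (Suc n)\<^sup>2 * (A * (1 / Suc n)\<^sup>2)"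
      by (intro mult_left_mono bound) auto
    also have "\<dots> = 2 * A" by (simp add: power_divide)
    finally show ?thesis by (simp add: ennreal_leI)
  qed
  have "(\<integral>\<^sup>+x. ennreal (x\<^sup>2) \<partial>M) = (\<integral>\<^sup>+x. liminf (\<lambda>n. ennreal (u n x)) \<partial>M)"
    by (intro nn_integral_cong lim_imp_Liminf[symmetric] tendsto_ennrealI lim) auto
  also have "\<dots> \<le> liminf (\<lambda>n. \<integral>\<^sup>+x. ennreal (u n x) \<partial>M)"
    by (intro nn_integral_liminf) auto
  also have "\<dots> \<le> ennreal (2 * A)"
    by (intro order_trans[OF Liminf_mono[OF always_eventually[OF allI[OF u]]]]) (simp add: Liminf_const)
  finally show ?thesis
    by (intro integrableI_bounded) (auto simp: less_top[symmetric] top_unique)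
qed

text \<open>Power bookkeeping for the tilting parameter \<open>(b / x) powr (1 + \<gamma>)\<close>
  in \<open>cdf_lower\<close>.\<close>

lemma
  fixes b c x :: real
  assumes "0 < b" "0 < x"
  shows divide_powr_Suc_mult: "(b / x) powr (1 + c) * x = b powr (1 + c) * x powr (- c)"
    and mult_divide_powr: "b * (b / x) powr c = (b / x) powr (1 + c) * x"
  using assms by (simp_all add: powr_divide powr_add powr_minus_divide)

section \<open>The convolution equation\<close>

locale TS_density =
  fixes \<alpha> \<beta> lam :: real and \<eta> :: "real measure" and g :: "real \<Rightarrow> real"
  assumes \<alpha>: "0 < \<alpha>" and lam: "0 < lam" and \<beta>: "0 < \<beta>" "\<beta> < 1"
    and TS: "is_TS \<alpha> \<beta> lam \<eta>"
    and dens: "is_continuous_density \<eta> g"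
begin

sublocale real_distribution \<eta>
  using TS by (simp add: is_TS_def)

lemma g_continuous: "continuous_on S g"
  using dens continuous_on_subset[of UNIV g S] by (auto simp: is_continuous_density_def)

lemma g_nonneg [simp]: "0 \<le> g x"
  using dens by (auto simp: is_continuous_density_def)

lemma \<eta>_eq: "\<eta> = density lborel (\<lambda>x. ennreal (g x))"
  using dens by (auto simp: is_continuous_density_def)

lemma g_measurable [measurable]: "g \<in> borel_measurable borel"
  by (intro borel_measurable_continuous_onI g_continuous)

text \<open>This is y times the Levy density. The extra factor weakens the singularity at 0 to
  y^(-\<beta>), which is integrable because \<beta> < 1.\<close>

definition k :: "real \<Rightarrow> real" where
  "k y = \<alpha> * (y powr (- \<beta>) * exp (- lam * y) * indicator {0<..} y)"

definition \<kappa> :: "real measure" where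
  "\<kappa> = density lborel (\<lambda>y. ennreal (k y))"

definition A :: real where "A = \<alpha> * Gamma (1 - \<beta>)"

abbreviation F :: "real measure" where "F \<equiv> TS_levy_measure \<alpha> \<beta> lam"

lemma A_pos: "0 < A"
  using \<alpha> \<beta> by (auto simp: A_def Gamma_real_pos)

lemma k_measurable [measurable]: "k \<in> borel_measurable borel"
  unfolding k_def by measurable

lemma k_nonneg [simp]: "0 \<le> k y"
  using \<alpha> by (simp add: k_def)

lemma sets_\<kappa> [measurable_cong, simp]: "sets \<kappa> = sets borel"
  by (simp add: \<kappa>_def)

lemma sets_F [measurable_cong, simp]: "sets F = sets borel"
  by (simp add: TS_levy_measure_def)

section \<open>Integrals against \<open>\<kappa>\<close> and the Levy measure\<close>

lemma nn_integral_\<kappa>_exp: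
  assumes "0 \<le> s"
  shows "(\<integral>\<^sup>+y. ennreal (exp (- s * y)) \<partial>\<kappa>) = ennreal (A * (lam + s) powr (\<beta> - 1))"
proof -
  have eq: "k y * exp (- s * y) =
      \<alpha> * (y powr ((1 - \<beta>) - 1) * exp (- (lam + s) * y) * indicator {0<..} y)" for y
    by (simp add: k_def algebra_simps exp_add[symmetric])
  have "(\<integral>\<^sup>+y. ennreal (exp (- s * y)) \<partial>\<kappa>) = (\<integral>\<^sup>+y. ennreal \<alpha> *
      ennreal (y powr ((1 - \<beta>) - 1) * exp (- (lam + s) * y) * indicator {0<..} y) \<partial>lborel)"
    unfolding \<kappa>_def using \<alpha>
    by (subst nn_integral_density)
      (auto intro!: nn_integral_cong simp: eq[simplified] ennreal_mult'[symmetric])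
  also have "\<dots> = ennreal \<alpha> * ennreal (Gamma (1 - \<beta>) / (lam + s) powr (1 - \<beta>))"
    using assms lam \<beta> by (subst nn_integral_cmult, simp, subst nn_integral_powr_exp) auto
  also have "\<dots> = ennreal (A * (lam + s) powr (\<beta> - 1))"
    using \<alpha> powr_minus_divide[of "lam + s" "1 - \<beta>"] by (simp add: ennreal_mult'[symmetric] A_def)
  finally show ?thesis .
qed

text \<open>The value is minus the derivative of the Laplace transform of \<open>\<kappa>\<close>
  and becomes the variance of the tilted law. The case s = 0 yields the first moment of
  \<open>\<kappa>\<close>.\<close>

lemma nn_integral_\<kappa>_ident_exp:
  assumes "0 \<le> s"
  shows "(\<integral>\<^sup>+y. ennreal (y * exp (- s * y)) \<partial>\<kappa>) = ennreal ((1 - \<beta>) * A * (lam + s) powr (\<beta> - 2))"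
proof -
  have eq: "k y * (y * exp (- s * y)) =
      \<alpha> * (y powr ((2 - \<beta>) - 1) * exp (- (lam + s) * y) * indicator {0<..} y)" for y
  proof (cases "0 < y")
    case True
    then have "y * y powr (- \<beta>) = y powr (2 - \<beta> - 1)"
      by (simp add: powr_mult_base)
    moreover have "exp (- (lam + s) * y) = exp (- lam * y) * exp (- s * y)"
      by (simp add: exp_add[symmetric] algebra_simps)
    ultimately show ?thesis using True by (simp add: k_def mult_ac)
  qed (simp add: k_def)
  have "(\<integral>\<^sup>+y. ennreal (y * exp (- s * y)) \<partial>\<kappa>) = (\<integral>\<^sup>+y. ennreal \<alpha> *
      ennreal (y powr ((2 - \<beta>) - 1) * exp (- (lam + s) * y) * indicator {0<..} y) \<partial>lborel)"
    unfolding \<kappa>_def using \<alpha>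
    by (subst nn_integral_density)
      (auto intro!: nn_integral_cong simp: eq[simplified] ennreal_mult'[symmetric])
  also have "\<dots> = ennreal \<alpha> * ennreal (Gamma (2 - \<beta>) / (lam + s) powr (2 - \<beta>))"
    using assms lam \<beta> by (subst nn_integral_cmult, simp, subst nn_integral_powr_exp) auto
  also have "Gamma (2 - \<beta>) = (1 - \<beta>) * Gamma (1 - \<beta>)"
  proof -
    have "1 - \<beta> \<notin> \<int>\<^sub>\<le>\<^sub>0" using \<beta> nonpos_Ints_nonpos[of "1 - \<beta>"] by auto
    from Gamma_plus1[OF this] show ?thesis by simp
  qed
  also have "ennreal \<alpha> * ennreal ((1 - \<beta>) * Gamma (1 - \<beta>) / (lam + s) powr (2 - \<beta>)) =
      ennreal ((1 - \<beta>) * A * (lam + s) powr (\<beta> - 2))"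
    using \<alpha> powr_minus_divide[of "lam + s" "2 - \<beta>"] by (simp add: ennreal_mult'[symmetric] A_def mult_ac)
  finally show ?thesis .
qed

lemma finite_measure_\<kappa>: "finite_measure \<kappa>"
  using nn_integral_\<kappa>_exp[of 0] by (intro finite_measureI) auto

text \<open>Expresses \<open>\<kappa>\<close>(dx) = x F(dx); both densities vanish off the positive
  half-line.\<close>

lemma integral_F_mult_ident:
  fixes f :: "real \<Rightarrow> 'b::{banach, second_countable_topology}"
  assumes [measurable]: "f \<in> borel_measurable borel"
  shows "integrable F (\<lambda>x. x *\<^sub>R f x) \<longleftrightarrow> integrable \<kappa> f"
    and "(\<integral>x. x *\<^sub>R f x \<partial>F) = (\<integral>x. f x \<partial>\<kappa>)"
proof -
  define m where "m x = \<alpha> / x powr (1 + \<beta>) * exp (- lam * x) * indicator {0<..} x" for x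
  have [measurable]: "m \<in> borel_measurable borel" unfolding m_def by measurable
  have m: "0 \<le> m x" for x using \<alpha> by (simp add: m_def)
  have mx: "m x * x = k x" for x
    by (cases "0 < x") (simp_all add: m_def k_def powr_add powr_minus_divide)
  have F: "F = density lborel (\<lambda>x. ennreal (m x))"
    by (simp add: TS_levy_measure_def m_def)
  show "integrable F (\<lambda>x. x *\<^sub>R f x) \<longleftrightarrow> integrable \<kappa> f"
    unfolding F \<kappa>_def using m by (simp add: integrable_density mx)
  show "(\<integral>x. x *\<^sub>R f x \<partial>F) = (\<integral>x. f x \<partial>\<kappa>)"
    unfolding F \<kappa>_def using m by (simp add: integral_density mx)
qed

lemma AE_\<kappa>_pos: "AE x in \<kappa>. 0 < x"
  unfolding \<kappa>_def by (subst AE_density) (auto simp: k_def indicator_def)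

lemma integrable_\<kappa>_ident: "integrable \<kappa> (\<lambda>y. y)"
proof (rule integrableI_bounded)
  have "(\<integral>\<^sup>+y. ennreal (norm y) \<partial>\<kappa>) = (\<integral>\<^sup>+y. ennreal (y * exp (- 0 * y)) \<partial>\<kappa>)"
    using AE_\<kappa>_pos by (intro nn_integral_cong_AE) auto
  then show "(\<integral>\<^sup>+y. ennreal (norm y) \<partial>\<kappa>) < \<infinity>"
    by (subst (asm) nn_integral_\<kappa>_ident_exp) (auto simp: less_top[symmetric])
qed simp

lemma integrable_F_ident: "integrable F (\<lambda>x. x)"
  and integrable_F_square: "integrable F (\<lambda>x. x\<^sup>2)"
proof -
  have "integrable \<kappa> (\<lambda>_. 1 :: real)"
    by (rule finite_measure.integrable_const[OF finite_measure_\<kappa>])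
  with integral_F_mult_ident(1)[of "\<lambda>_. 1 :: real", OF borel_measurable_const]
  show "integrable F (\<lambda>x. x)"
    unfolding real_scaleR_def mult_1_right by (rule iffD2)
  from integral_F_mult_ident(1)[of "\<lambda>x. x", OF measurable_ident_sets[OF refl]] integrable_\<kappa>_ident
  show "integrable F (\<lambda>x. x\<^sup>2)"
    unfolding real_scaleR_def power2_eq_square by (rule iffD2)
qed

section \<open>The characteristic exponent and the moments of \<open>\<eta>\<close>\<close>

definition \<Psi> :: "real \<Rightarrow> complex" where
  "\<Psi> z = (\<integral>x. (iexp (z * x) - 1) \<partial>F)"

lemma char_\<eta>: "char \<eta> z = exp (\<Psi> z)"
  using TS unfolding is_TS_def \<Psi>_def by blast

lemma integrable_F_iexp: "integrable F (\<lambda>x. iexp (z * x) - 1)"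
proof (rule Bochner_Integration.integrable_bound)
  show "integrable F (\<lambda>x. z * x)"
    by (intro integrable_mult_right integrable_F_ident)
  show "(\<lambda>x. iexp (z * x) - 1) \<in> borel_measurable F" by measurable
  show "AE x in F. norm (iexp (z * x) - 1) \<le> norm (z * x)"
    using norm_iexp_diff_le[of "z * x" 0 for x] by (intro AE_I2) simp
qed

text \<open>Near 0 the exponent has real part O(h^2) and imaginary part O(h), by the second and
  first moment of F. Hence the modulus E of the characteristic function and the cosine of its phase
  both differ from 1 by O(h^2).\<close>

lemma integrable_\<eta>_square: "integrable \<eta> (\<lambda>x. x\<^sup>2)"
proof (rule integrable_square_of_char)
  fix h :: real
  define m1 m2 where "m1 = (\<integral>x. \<bar>x\<bar> \<partial>F)" and "m2 = (\<integral>x. x\<^sup>2 \<partial>F)"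
  have re: "- Re (\<Psi> h) = (\<integral>x. 1 - cos (h * x) \<partial>F)"
    unfolding \<Psi>_def using integrable_F_iexp[of h]
    by (simp add: integral_Re[symmetric] Re_exp flip: Bochner_Integration.integral_minus)
  have re0: "0 \<le> - Re (\<Psi> h)"
    unfolding re by (intro Bochner_Integration.integral_nonneg) auto
  have "(\<integral>x. 1 - cos (h * x) \<partial>F) \<le> (\<integral>x. h\<^sup>2 / 2 * x\<^sup>2 \<partial>F)"
    using one_minus_cos_le[of "h * _"]
    by (intro integral_mono' integrable_mult_right integrable_F_square) (auto simp: power_mult_distrib)
  then have re1: "- Re (\<Psi> h) \<le> h\<^sup>2 / 2 * m2"
    unfolding re m2_def by simp
  have "norm (\<Psi> h) \<le> (\<integral>x. \<bar>h\<bar> * \<bar>x\<bar> \<partial>F)"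
    unfolding \<Psi>_def using norm_iexp_diff_le[of "h * _" 0] integrable_F_ident
    by (intro order_trans[OF integral_norm_bound] integral_mono' integrable_mult_right integrable_abs)
      (auto simp: abs_mult)
  then have im: "\<bar>Im (\<Psi> h)\<bar> \<le> \<bar>h\<bar> * m1"
    using abs_Im_le_cmod[of "\<Psi> h"] unfolding m1_def by simp
  have im2: "(Im (\<Psi> h))\<^sup>2 \<le> h\<^sup>2 * m1\<^sup>2"
    using power_mono[OF im, of 2] by (simp add: power_mult_distrib)
  define E where "E = exp (Re (\<Psi> h))"
  have E: "E \<le> 1" "1 - E \<le> - Re (\<Psi> h)" "0 \<le> E"
    using re0 exp_ge_add_one_self[of "Re (\<Psi> h)"] unfolding E_def by (simp, linarith, simp)
  have "1 - Re (char \<eta> h) = (1 - E) + E * (1 - cos (Im (\<Psi> h)))"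
    by (simp add: char_\<eta> Re_exp E_def algebra_simps)
  also have "\<dots> \<le> - Re (\<Psi> h) + 1 * (1 - cos (Im (\<Psi> h)))"
    using E by (intro add_mono mult_right_mono) auto
  also have "\<dots> \<le> h\<^sup>2 / 2 * m2 + (h\<^sup>2 * m1\<^sup>2) / 2"
    using re1 im2 one_minus_cos_le[of "Im (\<Psi> h)"] by auto
  also have "\<dots> = ((m2 + m1\<^sup>2) / 2) * h\<^sup>2" by (simp add: algebra_simps add_divide_distrib)
  finally show "1 - Re (char \<eta> h) \<le> (((\<integral>x. x\<^sup>2 \<partial>F) + (\<integral>x. \<bar>x\<bar> \<partial>F)\<^sup>2) / 2) * h\<^sup>2"
    unfolding m1_def m2_def .
qed

lemma integrable_\<eta>_ident: "integrable \<eta> (\<lambda>x. x)"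
  by (rule square_integrable_imp_integrable) (use integrable_\<eta>_square in auto)

text \<open>Two computations of the derivative of \<open>char \<eta>\<close>: by the chain rule from
  \<open>exp \<circ> \<Psi>\<close>, where the factor x turns F into \<open>\<kappa>\<close>, and
  under the integral over \<eta>.\<close>

lemma integral_ident_iexp:
  "(\<integral>x. of_real x * iexp (z * x) \<partial>\<eta>) = char \<eta> z * (\<integral>y. iexp (z * y) \<partial>\<kappa>)"
proof -
  have "(\<Psi> has_vector_derivative \<i> * (\<integral>x. of_real x * iexp (z * x) \<partial>F)) (at z)"
    unfolding \<Psi>_def using integrable_F_ident by (intro char_has_vector_derivative) auto
  then have "((exp \<circ> \<Psi>) has_vector_derivative \<i> * (\<integral>x. of_real x * iexp (z * x) \<partial>F) * exp (\<Psi> z)) (at z)"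
    by (intro field_vector_diff_chain_at) (auto intro: DERIV_exp)
  moreover have "(\<integral>x. of_real x * iexp (z * x) \<partial>F) = (\<integral>y. iexp (z * y) \<partial>\<kappa>)"
    using integral_F_mult_ident(2)[of "\<lambda>x. iexp (z * x)"] by (simp add: scaleR_conv_of_real)
  moreover have "(exp \<circ> \<Psi>) = char \<eta>" by (auto simp: char_\<eta>)
  ultimately have 1: "(char \<eta> has_vector_derivative \<i> * (\<integral>y. iexp (z * y) \<partial>\<kappa>) * char \<eta> z) (at z)"
    by (simp add: char_\<eta>)
  have "(\<integral>x. (iexp (z * x) - 1) \<partial>\<eta>) = char \<eta> z - 1" for z
  proof -
    have "integrable \<eta> (\<lambda>x. iexp (z * x))" by (intro integrable_iexp) auto
    then show ?thesis using prob_space by (simp add: char_def)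
  qed
  then have "((\<lambda>z. char \<eta> z - 1) has_vector_derivative \<i> * (\<integral>x. of_real x * iexp (z * x) \<partial>\<eta>)) (at z)"
    using char_has_vector_derivative[of \<eta> z] integrable_\<eta>_ident by simp
  then have "((\<lambda>z. char \<eta> z - 1 + 1) has_vector_derivative \<i> * (\<integral>x. of_real x * iexp (z * x) \<partial>\<eta>) + 0) (at z)"
    by (intro has_vector_derivative_add has_vector_derivative_const)
  then have "(char \<eta> has_vector_derivative \<i> * (\<integral>x. of_real x * iexp (z * x) \<partial>\<eta>)) (at z)"
    by simp
  with 1 have "\<i> * (\<integral>y. iexp (z * y) \<partial>\<kappa>) * char \<eta> z = \<i> * (\<integral>x. of_real x * iexp (z * x) \<partial>\<eta>)"
    by (rule vector_derivative_unique_at)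
  then show ?thesis by (simp add: mult_ac)
qed

section \<open>The convolution, its density and the support of \<open>\<eta>\<close>\<close>

lemma integral_iexp_convolution:
  "(\<integral>x. iexp (z * x) \<partial>(\<eta> \<star> \<kappa>)) = char \<eta> z * (\<integral>y. iexp (z * y) \<partial>\<kappa>)"
proof -
  interpret \<kappa>: finite_measure \<kappa> by (rule finite_measure_\<kappa>)
  interpret P: pair_sigma_finite \<eta> \<kappa> ..
  interpret PF: finite_measure "\<eta> \<Otimes>\<^sub>M \<kappa>"
    by (intro finite_measure_pair_measure finite_measure_axioms finite_measure_\<kappa>)
  have int: "integrable (\<eta> \<Otimes>\<^sub>M \<kappa>) (\<lambda>p. iexp (z * (fst p + snd p)))"
    by (intro PF.integrable_const_bound[where B=1]) auto
  have "(\<integral>x. iexp (z * x) \<partial>(\<eta> \<star> \<kappa>)) = (\<integral>p. iexp (z * (fst p + snd p)) \<partial>(\<eta> \<Otimes>\<^sub>M \<kappa>))"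
    unfolding convolution_def by (subst integral_distr) (auto simp: case_prod_beta)
  also have "\<dots> = (\<integral>x. (\<integral>y. iexp (z * (x + y)) \<partial>\<kappa>) \<partial>\<eta>)"
    using P.integral_fst'[OF int] by simp
  also have "\<dots> = (\<integral>x. iexp (z * x) * (\<integral>y. iexp (z * y) \<partial>\<kappa>) \<partial>\<eta>)"
    by (simp add: distrib_left exp_add)
  finally show ?thesis by (simp add: char_def)
qed

text \<open>Extended values avoid integrability conditions: finiteness is first obtained only almost
  everywhere, from the finite total mass of the convolution.\<close>

definition conv :: "real \<Rightarrow> ennreal" where
  "conv x = (\<integral>\<^sup>+y. ennreal (g (x - y)) * ennreal (k y) \<partial>lborel)"

lemma conv_measurable [measurable]: "conv \<in> borel_measurable borel"
  unfolding conv_def by measurable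

lemma convolution_eq: "\<eta> \<star> \<kappa> = density lborel conv"
  unfolding conv_def
  by (subst \<eta>_eq, unfold \<kappa>_def, rule convolution_density)
    (use finite_measure_axioms finite_measure_\<kappa> in \<open>simp_all add: \<eta>_eq[symmetric] \<kappa>_def[symmetric]\<close>)

text \<open>Both sides have the Fourier transform \<open>- \<i> \<phi>'\<close>. This is the only place where the
  characteristic function is inverted; it also locates the support of \<^term>\<open>\<eta>\<close>, as the
  right-hand side is nonnegative.\<close>

lemma AE_ident_mult_g: "AE x in lborel. 0 \<le> x * g x \<and> ennreal (x * g x) = conv x"
proof -
  define c where "c x = enn2real (conv x)" for x
  have [measurable]: "c \<in> borel_measurable borel" unfolding c_def by measurable
  have "finite_measure (\<eta> \<star> \<kappa>)"
    by (intro convolution_finite finite_measure_axioms finite_measure_\<kappa>) auto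
  then have "emeasure (\<eta> \<star> \<kappa>) (space (\<eta> \<star> \<kappa>)) \<noteq> \<infinity>"
    by (simp add: finite_measure.emeasure_finite)
  then have fin: "(\<integral>\<^sup>+x. conv x \<partial>lborel) \<noteq> \<infinity>"
    by (simp add: convolution_eq emeasure_density)
  have "AE x in lborel. conv x \<noteq> \<infinity>"
    by (rule nn_integral_PInf_AE[OF _ fin]) auto
  then have conv_c: "AE x in lborel. conv x = ennreal (c x)"
    by eventually_elim (simp add: c_def less_top)
  have c: "0 \<le> c x" for x by (simp add: c_def)
  have ic: "integrable lborel c"
  proof (rule integrableI_nonneg)
    have "(\<integral>\<^sup>+x. ennreal (c x) \<partial>lborel) = (\<integral>\<^sup>+x. conv x \<partial>lborel)"
      using conv_c by (intro nn_integral_cong_AE) auto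
    then show "(\<integral>\<^sup>+x. ennreal (c x) \<partial>lborel) < \<infinity>" using fin by (simp add: less_top)
  qed (use c in auto)
  have conv_eq: "\<eta> \<star> \<kappa> = density lborel (\<lambda>x. ennreal (c x))"
    unfolding convolution_eq using conv_c by (intro density_cong) auto
  have ig: "integrable lborel (\<lambda>x. x * g x)"
    using integrable_\<eta>_ident unfolding \<eta>_eq by (subst (asm) integrable_density) (auto simp: mult_ac)
  have ie: "integrable lborel (\<lambda>x. iexp (z * x) * of_real (f x) :: complex)"
    if "integrable lborel f" for f :: "real \<Rightarrow> real" and z
    by (rule Bochner_Integration.integrable_bound[OF that]) (use that in \<open>auto simp: norm_mult\<close>)
  have "AE x in lborel. x * g x - c x = 0"
  proof (rule integrable_char_zero_imp_AE_zero)
    show "integrable lborel (\<lambda>x. x * g x - c x)" using ig ic by auto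
    fix z
    have "(\<integral>x. iexp (z * x) * of_real (c x) \<partial>lborel) = (\<integral>x. iexp (z * x) \<partial>(\<eta> \<star> \<kappa>))"
      unfolding conv_eq using c
      by (subst integral_density) (auto simp: scaleR_conv_of_real mult_ac)
    also have "\<dots> = (\<integral>x. of_real x * iexp (z * x) \<partial>\<eta>)"
      by (simp only: integral_iexp_convolution integral_ident_iexp)
    also have "\<dots> = (\<integral>x. iexp (z * x) * of_real (x * g x) \<partial>lborel)"
      unfolding \<eta>_eq by (subst integral_density) (auto simp: scaleR_conv_of_real mult_ac)
    finally show "(\<integral>x. iexp (z * x) * of_real (x * g x - c x) \<partial>lborel) = 0"
      using ie[OF ig, of z] ie[OF ic, of z] by (simp add: right_diff_distrib)
  qed
  with conv_c show ?thesis by eventually_elim (use c in auto)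
qed

text \<open>For x < 0 the inequality 0 \<le> x g(x) contradicts g(x) > 0; continuity passes from
  almost every x to every x and reaches the endpoint 0.\<close>

lemma g_eq_0: "x \<le> 0 \<Longrightarrow> g x = 0"
proof -
  have neg: "g x = 0" if "x < 0" for x
  proof -
    have "g x \<le> 0"
    proof (rule AE_lborel_le_continuous[where S="{..<0}" and f=g and g="\<lambda>_. 0"])
      show "AE x in lborel. x \<in> {..<0} \<longrightarrow> g x \<le> 0"
        using AE_ident_mult_g by eventually_elim (auto simp: zero_le_mult_iff)
    qed (use that g_continuous in auto)
    with g_nonneg[of x] show ?thesis by linarith
  qed
  assume "x \<le> 0"
  then have "x \<in> closure {..<0::real}" by simp
  then show "g x = 0"
    using continuous_constant_on_closure[OF g_continuous[of "closure {..<0}"], of 0 x] neg by auto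
qed

lemma AE_\<eta>_pos: "AE x in \<eta>. 0 < x"
proof -
  have "0 < x" if "0 < g x" for x
    using that g_eq_0[of x] by (cases "x \<le> 0") auto
  then show ?thesis by (subst \<eta>_eq, subst AE_density) auto
qed

text \<open>The convolution equation in weak form, a size-bias identity: each factor x is traded for
  an independent shift distributed according to \<open>\<kappa>\<close>. Exponential test functions
  then factorise.\<close>

lemma nn_integral_\<eta>_mult_ident:
  assumes [measurable]: "f \<in> borel_measurable borel"
  shows "(\<integral>\<^sup>+x. ennreal x * f x \<partial>\<eta>) = (\<integral>\<^sup>+x. (\<integral>\<^sup>+y. f (x + y) \<partial>\<kappa>) \<partial>\<eta>)"
proof -
  have "(\<integral>\<^sup>+x. ennreal x * f x \<partial>\<eta>) = (\<integral>\<^sup>+x. ennreal (g x) * (ennreal x * f x) \<partial>lborel)"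
    by (subst \<eta>_eq, subst nn_integral_density) auto
  also have "\<dots> = (\<integral>\<^sup>+x. conv x * f x \<partial>lborel)"
  proof (rule nn_integral_cong_AE)
    show "AE x in lborel. ennreal (g x) * (ennreal x * f x) = conv x * f x"
      using AE_ident_mult_g
    proof eventually_elim
      case (elim x)
      then have "conv x = ennreal (g x) * ennreal x"
        by (cases "0 \<le> x") (auto simp: ennreal_mult'[symmetric] mult_ac g_eq_0)
      then show ?case by (simp add: mult_ac)
    qed
  qed
  also have "\<dots> = (\<integral>\<^sup>+x. f x \<partial>(\<eta> \<star> \<kappa>))"
    unfolding convolution_eq by (subst nn_integral_density) auto
  also have "\<dots> = (\<integral>\<^sup>+x. (\<integral>\<^sup>+y. f (x + y) \<partial>\<kappa>) \<partial>\<eta>)"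
    by (intro nn_integral_convolution finite_measure_axioms finite_measure_\<kappa>) auto
  finally show ?thesis .
qed

section \<open>The Laplace transform\<close>

definition L :: "real \<Rightarrow> real" where
  "L s = (\<integral>x. exp (- s * x) \<partial>\<eta>)"

text \<open>The Laplace transform of \<open>\<kappa>\<close>, and also the mean of \<eta> tilted by
  exp(-s x), as \<open>nn_integral_ident_exp\<close> shows.\<close>

definition K :: "real \<Rightarrow> real" where
  "K s = A * (lam + s) powr (\<beta> - 1)"

lemma integrable_exp:
  assumes "0 \<le> s"
  shows "integrable \<eta> (\<lambda>x. exp (- s * x))"
  using AE_\<eta>_pos assms by (intro integrable_const_bound[where B=1]) auto

lemma L_nonneg: "0 \<le> L s"
  unfolding L_def by (intro Bochner_Integration.integral_nonneg) auto

lemma K_nonneg: "0 \<le> K s"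
  using A_pos by (simp add: K_def)

lemma nn_integral_exp:
  assumes "0 \<le> s"
  shows "(\<integral>\<^sup>+x. ennreal (exp (- s * x)) \<partial>\<eta>) = ennreal (L s)"
  unfolding L_def by (intro nn_integral_eq_integral integrable_exp assms) auto

lemma nn_integral_ident_exp:
  assumes "0 \<le> s"
  shows "(\<integral>\<^sup>+x. ennreal (x * exp (- s * x)) \<partial>\<eta>) = ennreal (L s * K s)"
proof -
  have "(\<integral>\<^sup>+x. ennreal (x * exp (- s * x)) \<partial>\<eta>) = (\<integral>\<^sup>+x. ennreal x * ennreal (exp (- s * x)) \<partial>\<eta>)"
    by (simp add: ennreal_mult'')
  also have "\<dots> = (\<integral>\<^sup>+x. (\<integral>\<^sup>+y. ennreal (exp (- s * (x + y))) \<partial>\<kappa>) \<partial>\<eta>)"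
    by (intro nn_integral_\<eta>_mult_ident) auto
  also have "\<dots> = (\<integral>\<^sup>+x. ennreal (exp (- s * x)) * (\<integral>\<^sup>+y. ennreal (exp (- s * y)) \<partial>\<kappa>) \<partial>\<eta>)"
    by (subst nn_integral_cmult[symmetric])
      (auto intro!: nn_integral_cong simp: ennreal_mult'[symmetric] exp_add[symmetric] algebra_simps)
  also have "\<dots> = ennreal (L s) * ennreal (K s)"
    using nn_integral_\<kappa>_exp[OF assms] nn_integral_exp[OF assms]
    by (simp only: K_def) (subst nn_integral_multc, auto)
  finally show ?thesis using L_nonneg by (simp add: ennreal_mult'[symmetric])
qed

text \<open>The size-bias identity with test function x exp(-s x): the x-part of x + y contributes
  \<open>(K s)\<^sup>2\<close>, the y-part contributes -K'(s), the tilted variance.\<close>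

lemma nn_integral_square_exp:
  assumes s: "0 \<le> s"
  shows "(\<integral>\<^sup>+x. ennreal (x\<^sup>2 * exp (- s * x)) \<partial>\<eta>)
    = ennreal (L s * ((K s)\<^sup>2 + (1 - \<beta>) * A * (lam + s) powr (\<beta> - 2)))"
proof -
  define V where "V = (1 - \<beta>) * A * (lam + s) powr (\<beta> - 2)"
  have V: "0 \<le> V" using A_pos \<beta> by (simp add: V_def)
  have "(\<integral>\<^sup>+x. ennreal (x\<^sup>2 * exp (- s * x)) \<partial>\<eta>) = (\<integral>\<^sup>+x. ennreal x * ennreal (x * exp (- s * x)) \<partial>\<eta>)"
    using AE_\<eta>_pos by (intro nn_integral_cong_AE, eventually_elim)
      (simp add: ennreal_mult'[symmetric] power2_eq_square mult_ac)
  also have "\<dots> = (\<integral>\<^sup>+x. (\<integral>\<^sup>+y. ennreal ((x + y) * exp (- s * (x + y))) \<partial>\<kappa>) \<partial>\<eta>)"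
    by (intro nn_integral_\<eta>_mult_ident) auto
  also have "\<dots> = (\<integral>\<^sup>+x. ennreal (x * exp (- s * x)) * ennreal (K s) + ennreal (exp (- s * x)) * ennreal V \<partial>\<eta>)"
  proof (rule nn_integral_cong_AE)
    show "AE x in \<eta>. (\<integral>\<^sup>+y. ennreal ((x + y) * exp (- s * (x + y))) \<partial>\<kappa>) =
        ennreal (x * exp (- s * x)) * ennreal (K s) + ennreal (exp (- s * x)) * ennreal V"
      using AE_\<eta>_pos
    proof eventually_elim
      case (elim x)
      have "(\<integral>\<^sup>+y. ennreal ((x + y) * exp (- s * (x + y))) \<partial>\<kappa>) =
          (\<integral>\<^sup>+y. ennreal (x * exp (- s * x)) * ennreal (exp (- s * y)) +
                 ennreal (exp (- s * x)) * ennreal (y * exp (- s * y)) \<partial>\<kappa>)"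
      proof (rule nn_integral_cong_AE)
        show "AE y in \<kappa>. ennreal ((x + y) * exp (- s * (x + y))) =
          ennreal (x * exp (- s * x)) * ennreal (exp (- s * y)) +
          ennreal (exp (- s * x)) * ennreal (y * exp (- s * y))"
          using AE_\<kappa>_pos
        proof eventually_elim
          case (elim y)
          have "(x + y) * exp (- s * (x + y)) =
            (x * exp (- s * x)) * exp (- s * y) + exp (- s * x) * (y * exp (- s * y))"
            by (simp add: exp_add[symmetric] algebra_simps)
          then show ?case
            using elim \<open>0 < x\<close> by (simp add: ennreal_mult'[symmetric] ennreal_plus[symmetric] del: ennreal_plus)
        qed
      qed
      also have "\<dots> = ennreal (x * exp (- s * x)) * (\<integral>\<^sup>+y. ennreal (exp (- s * y)) \<partial>\<kappa>) +
          ennreal (exp (- s * x)) * (\<integral>\<^sup>+y. ennreal (y * exp (- s * y)) \<partial>\<kappa>)"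
        by (subst nn_integral_add, simp, simp, subst nn_integral_cmult, simp, subst nn_integral_cmult) auto
      finally show ?case
        by (simp only: nn_integral_\<kappa>_exp[OF s] nn_integral_\<kappa>_ident_exp[OF s] K_def V_def)
    qed
  qed
  also have "\<dots> = ennreal (L s * K s) * ennreal (K s) + ennreal (L s) * ennreal V"
    by (subst nn_integral_add, simp, simp, subst nn_integral_multc, simp, subst nn_integral_multc, simp)
      (simp only: nn_integral_ident_exp[OF s] nn_integral_exp[OF s])
  also have "\<dots> = ennreal (L s * ((K s)\<^sup>2 + V))"
    using L_nonneg[of s] K_nonneg[of s] V
    by (simp add: ennreal_mult'[symmetric] ennreal_plus[symmetric] power2_eq_square algebra_simps del: ennreal_plus)
  finally show ?thesis by (simp add: V_def)
qed

lemma L_eq: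
  assumes "0 \<le> s"
  shows "L s = exp (- (A / \<beta> * ((lam + s) powr \<beta> - lam powr \<beta>)))"
proof -
  define \<psi> where "\<psi> s = A / \<beta> * ((lam + s) powr \<beta> - lam powr \<beta>)" for s
  have L': "(L has_real_derivative - (L s * K s)) (at s within {0..})" if s: "0 \<le> s" for s
  proof -
    have hb: "has_bochner_integral \<eta> (\<lambda>x. x * exp (- s * x)) (L s * K s)"
      using AE_\<eta>_pos L_nonneg K_nonneg nn_integral_ident_exp[OF s]
      by (intro has_bochner_integral_nn_integral) auto
    have "(L has_vector_derivative (\<integral>x. - (x * exp (- s * x)) \<partial>\<eta>)) (at s within {0..})"
      unfolding L_def
    proof (rule has_vector_derivative_integral)
      show "integrable \<eta> (\<lambda>x. exp (- t * x))" if "t \<in> {0..}" for t using integrable_exp that by simp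
      show "integrable \<eta> (\<lambda>x. \<bar>x\<bar>)" using integrable_\<eta>_ident by auto
      show "integrable \<eta> (\<lambda>x. - (x * exp (- s * x)))" using hb by (auto simp: has_bochner_integral_iff)
      show "AE x in \<eta>. norm (exp (- t * x) - exp (- s * x)) \<le> \<bar>t - s\<bar> * \<bar>x\<bar>" if "t \<in> {0..}" for t
        using AE_\<eta>_pos
      proof eventually_elim
        case (elim x)
        \<comment> \<open>On the positive half-line exp(-s x) is Lipschitz in s \<ge> 0 with
          constant x, by 1 - exp(-r) \<le> r; the moment of \<eta> dominates it.\<close>
        have *: "exp (- u * x) - exp (- v * x) \<le> (v - u) * x" if "0 \<le> u" "u \<le> v" for u v
        proof -
          have "exp (- u * x) - exp (- v * x) = exp (- u * x) * (1 - exp (- ((v - u) * x)))"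
            by (simp add: algebra_simps exp_add[symmetric])
          also have "\<dots> \<le> 1 * ((v - u) * x)"
          proof (rule mult_mono)
            show "1 - exp (- ((v - u) * x)) \<le> (v - u) * x"
              using exp_ge_add_one_self[of "- ((v - u) * x)"] by linarith
          qed (use that elim in auto)
          finally show ?thesis by simp
        qed
        have mono: "exp (- v * x) \<le> exp (- u * x)" if "u \<le> v" for u v
          using that elim by simp
        show ?case
        proof (cases "t \<le> s")
          case True
          then show ?thesis using *[of t s] mono[of t s] \<open>t \<in> {0..}\<close> elim by simp
        next
          case False
          then show ?thesis using *[of s t] mono[of s t] s elim by simp
        qed
      qed
      show "AE x in \<eta>. ((\<lambda>s. exp (- s * x)) has_vector_derivative - (x * exp (- s * x))) (at s within {0..})"
        by (auto intro!: derivative_eq_intros AE_I2 simp flip: has_real_derivative_iff_has_vector_derivative)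
    qed (use s in auto)
    then show ?thesis
      using hb by (simp add: has_real_derivative_iff_has_vector_derivative has_bochner_integral_iff)
  qed
  \<comment> \<open>exp \<psi> is the integrating factor of L' = - L K, since \<psi>' = K; the
    constant is 1 because \<psi>(0) = 0 and L(0) = 1.\<close>
  have "\<exists>c. \<forall>s\<in>{0..}. L s * exp (\<psi> s) = c"
  proof (rule has_field_derivative_zero_constant)
    fix s :: real assume "s \<in> {0..}"
    then have s: "0 \<le> s" by simp
    have "(\<psi> has_real_derivative K s) (at s within {0..})"
      unfolding \<psi>_def K_def using s lam \<beta> by (auto intro!: derivative_eq_intros simp: field_simps)
    then have "((\<lambda>s. L s * exp (\<psi> s)) has_real_derivative (- (L s * K s)) * exp (\<psi> s) + exp (\<psi> s) * K s * L s)
        (at s within {0..})"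
      by (intro derivative_intros L' s)
    then show "((\<lambda>s. L s * exp (\<psi> s)) has_real_derivative 0) (at s within {0..})"
      by (simp add: mult_ac)
  qed simp
  then have "L s * exp (\<psi> s) = L 0 * exp (\<psi> 0)" using assms by fastforce
  also have "\<dots> = 1" using prob_space by (simp add: L_def \<psi>_def)
  finally show ?thesis by (simp add: \<psi>_def exp_minus field_simps)
qed

section \<open>The distribution function near zero\<close>

definition \<gamma> :: real where "\<gamma> = \<beta> / (1 - \<beta>)"

text \<open>The minimum over p > 0 of p x - (A / \<beta>) p^\<beta> equals -C0 x^(-\<gamma>) and is
  attained at p = (A / x)^(1+\<gamma>).\<close>

definition C0 :: real where "C0 = (1 - \<beta>) / \<beta> * A powr (1 + \<gamma>)"

lemma \<gamma>: "0 < \<gamma>" "1 / (1 - \<beta>) = 1 + \<gamma>" "(1 + \<gamma>) * (1 - \<beta>) = 1" "\<beta> * (1 + \<gamma>) = \<gamma>"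
  using \<beta> by (auto simp: \<gamma>_def field_simps)

lemma C0_pos: "0 < C0"
  using A_pos \<beta> by (auto simp: C0_def intro!: mult_pos_pos divide_pos_pos)

lemma emeasure_\<eta>_lessThan: "emeasure \<eta> {..<x} = ennreal (cdf \<eta> x)"
  and isCont_cdf_\<eta>: "isCont (cdf \<eta>) x"
proof -
  have null: "emeasure \<eta> {x} = 0"
    by (subst \<eta>_eq, subst emeasure_density) (auto simp: nn_integral_0_iff_AE)
  then have "emeasure \<eta> ({..<x} \<union> {x}) = emeasure \<eta> {..<x}"
    by (intro emeasure_Un_null_set) (auto simp: null_sets_def)
  moreover have "{..<x} \<union> {x} = {..x}" by auto
  ultimately show "emeasure \<eta> {..<x} = ennreal (cdf \<eta> x)"
    by (simp add: cdf_def emeasure_eq_measure)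
  show "isCont (cdf \<eta>) x" using null by (simp add: isCont_cdf measure_def)
qed

lemma integrable_indicator_atMost: "integrable \<eta> (indicator {..x} :: real \<Rightarrow> real)"
  by (intro integrable_real_indicator) (auto simp: emeasure_eq_measure)

lemma integral_indicator_atMost: "(\<integral>y. indicator {..x} y \<partial>\<eta>) = cdf \<eta> x"
  by (simp add: cdf_def)

lemma cdf_le_Laplace:
  assumes "0 \<le> s"
  shows "cdf \<eta> x \<le> exp (s * x) * L s"
proof -
  have "cdf \<eta> x = (\<integral>y. indicator {..x} y \<partial>\<eta>)" by (simp only: integral_indicator_atMost)
  also have "\<dots> \<le> (\<integral>y. exp (s * x) * exp (- s * y) \<partial>\<eta>)"
  proof (rule integral_mono[OF integrable_indicator_atMost])
    show "integrable \<eta> (\<lambda>y. exp (s * x) * exp (- s * y))"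
      using integrable_exp[OF assms] by (rule integrable_mult_right)
    show "indicator {..x} y \<le> exp (s * x) * exp (- s * y)" for y
      using assms by (auto simp: indicator_def exp_add[symmetric] mult_left_mono)
  qed
  finally show ?thesis by (simp add: L_def)
qed

text \<open>The bound of \<open>cdf_le_Laplace\<close> is optimal at the \<open>s\<close> with \<open>K s = x\<close>.\<close>

lemma cdf_upper:
  assumes x: "0 < x" and le: "lam \<le> (A / x) powr (1 + \<gamma>)"
  shows "cdf \<eta> x \<le> exp (A / \<beta> * lam powr \<beta>) * exp (- (C0 * x powr (- \<gamma>)))"
proof -
  define p where "p = (A / x) powr (1 + \<gamma>)"
  have px: "p * x = A powr (1 + \<gamma>) * x powr (- \<gamma>)"
    using x A_pos by (simp add: p_def powr_divide powr_add powr_minus field_simps)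
  have "p powr \<beta> = (A / x) powr \<gamma>" by (simp add: p_def powr_powr \<gamma> mult.commute[of _ \<beta>])
  then have Ap: "A * p powr \<beta> = p * x"
    using x A_pos by (simp add: p_def powr_add)
  have "cdf \<eta> x \<le> exp ((p - lam) * x) * L (p - lam)"
    using le by (intro cdf_le_Laplace) (simp add: p_def)
  also have "\<dots> = exp ((p - lam) * x - (A * p powr \<beta>) / \<beta> + A / \<beta> * lam powr \<beta>)"
    using le by (subst L_eq) (auto simp: p_def exp_add[symmetric] algebra_simps)
  also have "\<dots> \<le> exp (p * x - (p * x) / \<beta> + A / \<beta> * lam powr \<beta>)"
    using x lam by (simp add: Ap left_diff_distrib)
  also have "p * x - (p * x) / \<beta> = - (C0 * x powr (- \<gamma>))"
    unfolding px using \<beta> by (simp add: C0_def field_simps)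
  finally show ?thesis by (simp add: exp_add[symmetric] add.commute)
qed

text \<open>Chebyshev's inequality for the exponentially tilted law \<open>exp (- s x) \<eta>(dx) / L s\<close>, whose
  mean is \<open>K s\<close> and whose variance is \<open>- K' s\<close>.\<close>

lemma cdf_ge_Laplace:
  assumes s: "0 \<le> s" and \<epsilon>: "0 < \<epsilon>"
  shows "L s * (1 - (1 - \<beta>) / (A * \<epsilon>\<^sup>2) * (lam + s) powr (- \<beta>))
    \<le> exp (- s * ((1 - \<epsilon>) * K s)) * cdf \<eta> ((1 + \<epsilon>) * K s)"
proof -
  define m where "m = K s"
  define v where "v = (1 - \<beta>) * A * (lam + s) powr (\<beta> - 2)"
  have m: "0 < m" using A_pos s lam by (auto simp: m_def K_def)
  have v: "0 \<le> v" using A_pos \<beta> by (simp add: v_def)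
  have h0: "has_bochner_integral \<eta> (\<lambda>x. exp (- s * x)) (L s)"
    using integrable_exp[OF s] by (simp add: has_bochner_integral_iff L_def)
  have h1: "has_bochner_integral \<eta> (\<lambda>x. x * exp (- s * x)) (L s * m)"
    using AE_\<eta>_pos L_nonneg K_nonneg nn_integral_ident_exp[OF s] unfolding m_def
    by (intro has_bochner_integral_nn_integral) auto
  have h2: "has_bochner_integral \<eta> (\<lambda>x. x\<^sup>2 * exp (- s * x)) (L s * (m\<^sup>2 + v))"
    using L_nonneg v nn_integral_square_exp[OF s] unfolding m_def v_def
    by (intro has_bochner_integral_nn_integral) auto
  have "has_bochner_integral \<eta> (\<lambda>x. x\<^sup>2 * exp (- s * x) - 2 * m * (x * exp (- s * x)) + m\<^sup>2 * exp (- s * x))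
      (L s * (m\<^sup>2 + v) - 2 * m * (L s * m) + m\<^sup>2 * L s)"
    by (intro has_bochner_integral_add has_bochner_integral_diff has_bochner_integral_mult_right h0 h1 h2)
  also have "(\<lambda>x. x\<^sup>2 * exp (- s * x) - 2 * m * (x * exp (- s * x)) + m\<^sup>2 * exp (- s * x)) =
      (\<lambda>x. (x - m)\<^sup>2 * exp (- s * x))"
    by (auto simp: power2_eq_square algebra_simps)
  also have "L s * (m\<^sup>2 + v) - 2 * m * (L s * m) + m\<^sup>2 * L s = L s * v"
    by (simp add: power2_eq_square algebra_simps)
  finally have var: "has_bochner_integral \<eta> (\<lambda>x. (x - m)\<^sup>2 * exp (- s * x)) (L s * v)" .
  \<comment> \<open>Inside the window |x - m| \<le> \<epsilon> m the exponential is at most its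
    value at the left end; outside, the Chebyshev factor is at least 1.\<close>
  have bound: "exp (- s * x) \<le> exp (- s * ((1 - \<epsilon>) * m)) * indicator {..(1 + \<epsilon>) * m} x +
      1 / (\<epsilon> * m)\<^sup>2 * ((x - m)\<^sup>2 * exp (- s * x))" for x
  proof (cases "\<bar>x - m\<bar> \<le> \<epsilon> * m")
    case True
    then have "(1 - \<epsilon>) * m \<le> x" "x \<le> (1 + \<epsilon>) * m" by (auto simp: algebra_simps abs_le_iff)
    then have "exp (- s * x) \<le> exp (- s * ((1 - \<epsilon>) * m)) * indicator {..(1 + \<epsilon>) * m} x"
      using s by (simp add: mult_left_mono)
    then show ?thesis by (simp add: add_increasing2)
  next
    case False
    then have "(\<epsilon> * m)\<^sup>2 \<le> (x - m)\<^sup>2"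
      using \<epsilon> m by (intro abs_le_square_iff[THEN iffD1]) auto
    then have "1 \<le> 1 / (\<epsilon> * m)\<^sup>2 * (x - m)\<^sup>2" using \<epsilon> m by simp
    then have "1 * exp (- s * x) \<le> (1 / (\<epsilon> * m)\<^sup>2 * (x - m)\<^sup>2) * exp (- s * x)"
      by (intro mult_right_mono) auto
    then show ?thesis by (simp add: add_increasing mult.assoc)
  qed
  have "L s \<le> (\<integral>x. exp (- s * ((1 - \<epsilon>) * m)) * indicator {..(1 + \<epsilon>) * m} x +
      1 / (\<epsilon> * m)\<^sup>2 * ((x - m)\<^sup>2 * exp (- s * x)) \<partial>\<eta>)"
    unfolding L_def
    by (intro integral_mono bound Bochner_Integration.integrable_add integrable_mult_right
        integrable_exp s integrable_indicator_atMost)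
      (use var in \<open>simp add: has_bochner_integral_iff\<close>)
  also have "\<dots> = exp (- s * ((1 - \<epsilon>) * m)) * cdf \<eta> ((1 + \<epsilon>) * m) + 1 / (\<epsilon> * m)\<^sup>2 * (L s * v)"
    using var integrable_indicator_atMost[of "(1 + \<epsilon>) * m"]
    by (subst Bochner_Integration.integral_add) (auto simp: has_bochner_integral_iff cdf_def)
  also have "1 / (\<epsilon> * m)\<^sup>2 * (L s * v) = L s * ((1 - \<beta>) / (A * \<epsilon>\<^sup>2) * (lam + s) powr (- \<beta>))"
  proof -
    \<comment> \<open>The relative variance is of order (lam + s)^(-\<beta>): it vanishes as s
      grows, so the tilted law concentrates at its mean.\<close>
    have "v / m\<^sup>2 = (1 - \<beta>) / A * (lam + s) powr ((\<beta> - 2) - 2 * (\<beta> - 1))"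
      using A_pos s lam unfolding v_def m_def K_def
      by (subst powr_diff) (simp add: power2_eq_square powr_add[symmetric])
    then have "v / m\<^sup>2 = (1 - \<beta>) / A * (lam + s) powr (- \<beta>)" by simp
    moreover have "1 / (\<epsilon> * m)\<^sup>2 * (L s * v) = L s * ((v / m\<^sup>2) / \<epsilon>\<^sup>2)"
      by (simp add: power_mult_distrib)
    ultimately show ?thesis by simp
  qed
  finally show ?thesis by (simp add: m_def algebra_simps)
qed

text \<open>A perturbation of C0, recovered at \<epsilon> = 0. The power of 1 + \<epsilon> comes
  from tilting to mean x / (1 + \<epsilon>) instead of x, the summand \<epsilon> from evaluating the
  exponential at the left end of the window.\<close>

definition D0 :: "real \<Rightarrow> real" where
  "D0 \<epsilon> = (1 + \<epsilon>) powr \<gamma> * A powr (1 + \<gamma>) * (1 / \<beta> - 1 + \<epsilon>)"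

text \<open>The tilt p = lam + s places the right end of the Chebyshev window exactly at x. The
  assumption \<open>half\<close> leaves at least half of the tilted mass in the window, which costs
  the term ln 2.\<close>

lemma cdf_lower:
  assumes x: "0 < x" and \<epsilon>: "0 < \<epsilon>" "\<epsilon> < 1"
    and p: "p = ((1 + \<epsilon>) * A / x) powr (1 + \<gamma>)" "lam \<le> p"
    and half: "(1 - \<beta>) / (A * \<epsilon>\<^sup>2) * p powr (- \<beta>) \<le> 1 / 2"
  shows "exp (- (D0 \<epsilon> * x powr (- \<gamma>) + lam * x + ln 2)) \<le> cdf \<eta> x"
proof -
  define s where "s = p - lam"
  have s: "0 \<le> s" "lam + s = p" using p by (auto simp: s_def)
  define B where "B = (1 + \<epsilon>) * A"
  have B: "0 < B" using \<epsilon> A_pos by (simp add: B_def)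
  have ppos: "0 < p" using x \<epsilon> A_pos by (simp add: p)
  have px: "p * x = B powr (1 + \<gamma>) * x powr (- \<gamma>)"
    using divide_powr_Suc_mult[OF B x, of \<gamma>] by (simp add: p B_def)
  have "p powr \<beta> = (B / x) powr \<gamma>" by (simp add: p B_def powr_powr \<gamma> mult.commute[of _ \<beta>])
  then have Bp: "B * p powr \<beta> = p * x"
    using mult_divide_powr[OF B x, of \<gamma>] by (simp add: p B_def)
  have m: "(1 + \<epsilon>) * K s = x"
  proof -
    have "p * ((1 + \<epsilon>) * K s) = B * p powr \<beta>"
      using ppos by (simp add: K_def s B_def powr_diff)
    then show ?thesis using Bp ppos by simp
  qed
  define y where "y = K s"
  have y: "x = (1 + \<epsilon>) * y" "0 \<le> y" "y \<le> x" using m K_nonneg[of s] \<epsilon> by (auto simp: y_def algebra_simps)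
  have Ap: "A * p powr \<beta> = p * y"
    using Bp \<epsilon> unfolding B_def y by (simp add: mult_ac)
  have D: "D0 \<epsilon> * x powr (- \<gamma>) = p * y * (1 / \<beta> - 1 + \<epsilon>)"
  proof -
    have "(1 + \<epsilon>) * (p * y) = (1 + \<epsilon>) * ((1 + \<epsilon>) powr \<gamma> * A powr (1 + \<gamma>) * x powr (- \<gamma>))"
      using px \<epsilon> A_pos unfolding B_def y(1) by (simp add: powr_mult powr_add mult_ac)
    then show ?thesis using \<epsilon> by (simp add: D0_def)
  qed
  \<comment> \<open>Replacing s by p costs at most lam x, and the nonnegative term with lam^\<beta>
    is dropped.\<close>
  have "- (D0 \<epsilon> * x powr (- \<gamma>) + lam * x + ln 2) \<le> s * ((1 - \<epsilon>) * y) - A / \<beta> * (p powr \<beta> - lam powr \<beta>) - ln 2"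
  proof -
    have "lam * ((1 - \<epsilon>) * y) \<le> lam * x"
      using lam y \<epsilon> by (intro mult_left_mono) (auto simp: algebra_simps)
    moreover have "0 \<le> A / \<beta> * lam powr \<beta>" using A_pos \<beta> by simp
    moreover have "A / \<beta> * p powr \<beta> = p * y / \<beta>"
      by (simp only: times_divide_eq_left Ap)
    moreover have "s * ((1 - \<epsilon>) * y) = p * y - \<epsilon> * (p * y) - lam * ((1 - \<epsilon>) * y)"
      by (simp add: s_def algebra_simps)
    moreover have "p * y * (1 / \<beta> - 1 + \<epsilon>) = p * y / \<beta> - p * y + \<epsilon> * (p * y)"
      by (simp add: algebra_simps)
    ultimately show ?thesis unfolding D by (simp only: right_diff_distrib)
  qed
  then have "exp (- (D0 \<epsilon> * x powr (- \<gamma>) + lam * x + ln 2)) \<le>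
      exp (s * ((1 - \<epsilon>) * y) - A / \<beta> * (p powr \<beta> - lam powr \<beta>) - ln 2)" by simp
  also have "\<dots> = exp (s * ((1 - \<epsilon>) * y)) * (L s * (1 / 2))"
    using s by (subst L_eq) (auto simp: exp_diff exp_minus exp_add field_simps)
  also have "\<dots> \<le> exp (s * ((1 - \<epsilon>) * y)) * (L s * (1 - (1 - \<beta>) / (A * \<epsilon>\<^sup>2) * (lam + s) powr (- \<beta>)))"
    using half L_nonneg[of s] by (intro mult_left_mono) (auto simp: s(2))
  also have "\<dots> \<le> exp (s * ((1 - \<epsilon>) * y)) * (exp (- s * ((1 - \<epsilon>) * y)) * cdf \<eta> x)"
    using cdf_ge_Laplace[OF s(1) \<epsilon>(1)] by (intro mult_left_mono) (auto simp: m y_def)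
  also have "\<dots> = cdf \<eta> x" by (simp add: mult.assoc[symmetric] exp_add[symmetric])
  finally show ?thesis .
qed

section \<open>The density near zero\<close>

lemma k_antimono: "0 < x \<Longrightarrow> x \<le> y \<Longrightarrow> k y \<le> k x"
  unfolding k_def using \<alpha> \<beta> lam
  by (intro mult_left_mono mult_mono powr_mono2') auto

lemma k_le: "0 < y \<Longrightarrow> k y \<le> \<alpha> * y powr (- \<beta>)"
  using \<alpha> lam by (auto simp: k_def mult_left_le)

lemma nn_integral_g_shift:
  "(\<integral>\<^sup>+y. ennreal (g (t - y)) * indicator {0<..} y \<partial>lborel) = ennreal (cdf \<eta> t)"
proof -
  have "ennreal (cdf \<eta> t) = emeasure \<eta> {..<t}" by (simp only: emeasure_\<eta>_lessThan)
  also have "\<dots> = (\<integral>\<^sup>+y. ennreal (g y) * indicator {..<t} y \<partial>lborel)"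
    by (subst \<eta>_eq, subst emeasure_density) auto
  also have "\<dots> = ennreal \<bar>- 1\<bar> * (\<integral>\<^sup>+y. ennreal (g (t + - 1 * y)) * indicator {..<t} (t + - 1 * y) \<partial>lborel)"
    by (rule nn_integral_real_affine) auto
  also have "\<dots> = (\<integral>\<^sup>+y. ennreal (g (t - y)) * indicator {0<..} y \<partial>lborel)"
    by (auto intro!: nn_integral_cong simp: indicator_def)
  finally show ?thesis by simp
qed

lemma conv_ge:
  assumes "0 < t"
  shows "ennreal (k t * cdf \<eta> t) \<le> conv t"
proof -
  have "ennreal (k t * cdf \<eta> t) = ennreal (k t) * (\<integral>\<^sup>+y. ennreal (g (t - y)) * indicator {0<..} y \<partial>lborel)"
    by (simp add: nn_integral_g_shift ennreal_mult')
  also have "\<dots> = (\<integral>\<^sup>+y. ennreal (k t) * (ennreal (g (t - y)) * indicator {0<..} y) \<partial>lborel)"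
    by (rule nn_integral_cmult[symmetric]) auto
  also have "\<dots> \<le> conv t"
    unfolding conv_def
  proof (rule nn_integral_mono)
    fix y
    show "ennreal (k t) * (ennreal (g (t - y)) * indicator {0<..} y) \<le> ennreal (g (t - y)) * ennreal (k y)"
    \<comment> \<open>Only 0 < y < t contributes, as g vanishes on the nonpositive half-line; there
      k(y) \<ge> k(t).\<close>
    proof (cases "0 < y \<and> y < t")
      case True
      then have "ennreal (g (t - y)) * ennreal (k t) \<le> ennreal (g (t - y)) * ennreal (k y)"
        by (intro mult_left_mono ennreal_leI k_antimono) auto
      then show ?thesis using True by (simp add: mult.commute)
    qed (auto simp: g_eq_0 indicator_def)
  qed
  finally show ?thesis .
qed

text \<open>Near the singularity of k, for y \<le> \<epsilon>, g is replaced by its bound M and k by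
  \<alpha> y^(-\<beta>), which is integrated explicitly. For y \<ge> \<epsilon>, k is at most
  k(\<epsilon>) and g integrates to at most the distribution function.\<close>

lemma conv_le:
  assumes M: "\<And>y. y < t \<Longrightarrow> g y \<le> M" "0 \<le> M" and \<epsilon>: "0 < \<epsilon>"
  shows "conv t \<le> ennreal (M * (\<alpha> / (1 - \<beta>)) * \<epsilon> powr (1 - \<beta>) + k \<epsilon> * cdf \<eta> t)"
proof -
  have int: "(\<integral>\<^sup>+y. ennreal (indicator {0..\<epsilon>} y * y powr (- \<beta>)) \<partial>lborel) = ennreal (\<epsilon> powr (1 - \<beta>) / (1 - \<beta>))"
    using has_integral_powr_from_0[of "- \<beta>" \<epsilon>] \<beta> \<epsilon>
    by (subst nn_integral_has_integral_lebesgue[where I="\<epsilon> powr (1 - \<beta>) / (1 - \<beta>)"]) (auto simp: add.commute)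
  have "conv t \<le> (\<integral>\<^sup>+y. ennreal (M * \<alpha>) * ennreal (indicator {0..\<epsilon>} y * y powr (- \<beta>)) +
      ennreal (k \<epsilon>) * (ennreal (g (t - y)) * indicator {0<..} y) \<partial>lborel)"
    unfolding conv_def
  proof (rule nn_integral_mono)
    fix y
    consider "y \<le> 0" | "0 < y" "y \<le> \<epsilon>" | "0 < y" "\<epsilon> \<le> y" by linarith
    then show "ennreal (g (t - y)) * ennreal (k y) \<le>
      ennreal (M * \<alpha>) * ennreal (indicator {0..\<epsilon>} y * y powr (- \<beta>)) +
      ennreal (k \<epsilon>) * (ennreal (g (t - y)) * indicator {0<..} y)"
    proof cases
      case 1
      then show ?thesis by (simp add: k_def)
    next
      case 2
      have "g (t - y) * k y \<le> M * (\<alpha> * y powr (- \<beta>))"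
        using 2 M by (intro mult_mono k_le) auto
      then have "ennreal (g (t - y) * k y) \<le> ennreal (M * \<alpha> * y powr (- \<beta>))"
        by (intro ennreal_leI) (simp add: mult.assoc)
      then show ?thesis
        using 2 M \<alpha> by (intro add_increasing2) (auto simp: ennreal_mult'[symmetric])
    next
      case 3
      then have "ennreal (g (t - y)) * ennreal (k y) \<le> ennreal (g (t - y)) * ennreal (k \<epsilon>)"
        using \<epsilon> by (intro mult_left_mono ennreal_leI k_antimono) auto
      then show ?thesis
        using 3 by (intro add_increasing) (auto simp: mult.commute)
    qed
  qed
  also have "\<dots> = ennreal (M * \<alpha>) * ennreal (\<epsilon> powr (1 - \<beta>) / (1 - \<beta>)) + ennreal (k \<epsilon>) * ennreal (cdf \<eta> t)"
    by (subst nn_integral_add, simp, simp, subst nn_integral_cmult, simp, subst nn_integral_cmult, simp)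
      (simp only: int nn_integral_g_shift)
  also have "\<dots> = ennreal (M * (\<alpha> / (1 - \<beta>)) * \<epsilon> powr (1 - \<beta>) + k \<epsilon> * cdf \<eta> t)"
    using M \<alpha> \<beta> by (simp add: ennreal_mult'[symmetric] ennreal_plus[symmetric] cdf_nonneg del: ennreal_plus)
  finally show ?thesis .
qed

lemma g_lower:
  assumes "0 < t"
  shows "k t * cdf \<eta> t \<le> t * g t"
proof (rule AE_lborel_le_continuous[where S="{0<..}" and x=t
      and f="\<lambda>t. k t * cdf \<eta> t" and g="\<lambda>t. t * g t"])
  show "continuous_on {0<..} (\<lambda>t. k t * cdf \<eta> t)"
  proof (intro continuous_on_mult)
    have "continuous_on {0<..} (\<lambda>t. \<alpha> * (t powr (- \<beta>) * exp (- lam * t)))"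
      by (intro continuous_intros) auto
    then show "continuous_on {0<..} k"
      by (rule continuous_on_eq) (auto simp: k_def)
    show "continuous_on {0<..} (cdf \<eta>)"
      using isCont_cdf_\<eta> by (intro continuous_at_imp_continuous_on) auto
  qed
  show "continuous_on {0<..} (\<lambda>t. t * g t)" by (intro continuous_intros g_continuous)
  show "AE t in lborel. t \<in> {0<..} \<longrightarrow> k t * cdf \<eta> t \<le> t * g t"
    using AE_ident_mult_g
  proof eventually_elim
    case (elim t)
    then show ?case using conv_ge[of t] by (metis ennreal_le_iff greaterThan_iff)
  qed
  show "t \<in> {0<..}" using assms by simp
qed simp

text \<open>Both sides of the inequality are continuous, so it extends from almost every t in (0, x)
  to the closed interval. The endpoint matters: the maximum of g may be attained at x
  itself.\<close>

lemma g_upper: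
  assumes x: "0 < x" and M: "\<And>y. y < x \<Longrightarrow> g y \<le> M" "0 \<le> M" and \<epsilon>: "0 < \<epsilon>" and t: "0 \<le> t" "t \<le> x"
  shows "t * g t \<le> M * (\<alpha> / (1 - \<beta>)) * \<epsilon> powr (1 - \<beta>) + k \<epsilon> * cdf \<eta> t"
proof -
  define r where "r t = M * (\<alpha> / (1 - \<beta>)) * \<epsilon> powr (1 - \<beta>) + k \<epsilon> * cdf \<eta> t" for t
  have r: "continuous_on S r" for S
    unfolding r_def using isCont_cdf_\<eta> by (intro continuous_intros continuous_at_imp_continuous_on) auto
  have l: "continuous_on S (\<lambda>t. t * g t)" for S by (intro continuous_intros g_continuous)
  have "t * g t \<le> r t" if "t \<in> {0<..<x}" for t
  proof (rule AE_lborel_le_continuous[where S="{0<..<x}" and x=t and f="\<lambda>t. t * g t" and g=r])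
    show "AE t in lborel. t \<in> {0<..<x} \<longrightarrow> t * g t \<le> r t"
      using AE_ident_mult_g
    proof eventually_elim
      case (elim t)
      have "conv t \<le> ennreal (r t)" if "t < x"
        unfolding r_def using that by (intro conv_le M \<epsilon>) auto
      moreover have "0 \<le> r t" unfolding r_def using M \<alpha> \<beta> by (simp add: cdf_nonneg)
      ultimately show ?case using elim by (metis ennreal_le_iff greaterThanLessThan_iff)
    qed
  qed (use l r that in auto)
  moreover have "t \<in> closure {0<..<x}" using x t by simp
  moreover have "continuous_on (closure {0<..<x}) (\<lambda>t. t * g t - r t)"
    by (intro continuous_on_diff l r)
  ultimately have "t * g t - r t \<le> 0"
    by (intro continuous_le_on_closure[where S="{0<..<x}" and x=t and f="\<lambda>t. t * g t - r t"]) auto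
  then show ?thesis by (simp add: r_def)
qed

text \<open>At a maximum point \<open>t\<close> of \<open>g\<close> on \<open>{0..x}\<close>, the width \<open>\<epsilon>\<close> in \<open>g_upper\<close> is chosen such that
  the first summand equals \<open>t * g t / 2\<close> and can be absorbed.\<close>

lemma g_le_cdf:
  obtains c where "0 < c"
    "\<And>x. 0 < x \<Longrightarrow> 0 < g x \<Longrightarrow> \<exists>t. 0 < t \<and> t \<le> x \<and> g x \<le> c * t powr (- (1 + \<gamma>)) * cdf \<eta> t"
proof
  define B where "B = \<alpha> / (1 - \<beta>)"
  have B: "0 < B" using \<alpha> \<beta> by (simp add: B_def)
  define c where "c = 2 * (\<alpha> * (2 * B) powr \<gamma>)"
  show "0 < 2 * (\<alpha> * (2 * (\<alpha> / (1 - \<beta>))) powr \<gamma>)" 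
    using \<alpha> B unfolding B_def by (intro mult_pos_pos) auto
  fix x assume x: "0 < x" "0 < g x"
  obtain t where t: "t \<in> {0..x}" "\<forall>y\<in>{0..x}. g y \<le> g t"
    using continuous_attains_sup[of "{0..x}" g] g_continuous x by (auto simp: less_imp_le)
  have gt: "g x \<le> g t" using t x by simp
  have tpos: "0 < t" using gt x t g_eq_0[of t] by (cases "t = 0") auto
  define \<epsilon> where "\<epsilon> = (t / (2 * B)) powr (1 + \<gamma>)"
  have \<epsilon>: "0 < \<epsilon>" using tpos B by (simp add: \<epsilon>_def)
  have e1: "B * \<epsilon> powr (1 - \<beta>) = t / 2"
    using tpos B by (simp add: \<epsilon>_def powr_powr \<gamma>)
  \<comment> \<open>As \<beta> (1 + \<gamma>) = \<gamma>, the bound on k(\<epsilon>) costs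
    t^(-\<gamma>); cancelling t in \<open>t * g t\<close> then gives the exponent -(1 +
    \<gamma>).\<close>
  have e2: "\<epsilon> powr (- \<beta>) = (2 * B) powr \<gamma> * t powr (- \<gamma>)"
    using tpos B by (simp add: \<epsilon>_def powr_powr mult.commute[of _ \<beta>] \<gamma> powr_divide powr_minus field_simps)
  have "t * g t \<le> g t * (\<alpha> / (1 - \<beta>)) * \<epsilon> powr (1 - \<beta>) + k \<epsilon> * cdf \<eta> t"
  proof (rule g_upper[where x=x])
    show "g y \<le> g t" if "y < x" for y
      using t that g_eq_0[of y] by (cases "y \<le> 0") auto
  qed (use x t \<epsilon> in auto)
  also have "g t * (\<alpha> / (1 - \<beta>)) * \<epsilon> powr (1 - \<beta>) = g t * t / 2"
    using arg_cong[OF e1, of "(*) (g t)"]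
    by (simp only: B_def mult.assoc times_divide_eq_right times_divide_eq_left)
  finally have "t * g t \<le> 2 * (k \<epsilon> * cdf \<eta> t)" by (simp add: mult.commute)
  also have "\<dots> \<le> 2 * ((\<alpha> * \<epsilon> powr (- \<beta>)) * cdf \<eta> t)"
    using k_le[OF \<epsilon>] by (intro mult_left_mono mult_right_mono) (auto simp: cdf_nonneg)
  also have "\<dots> = t * (c * t powr (- (1 + \<gamma>)) * cdf \<eta> t)"
  proof -
    have "t powr (- \<gamma>) = t * t powr (- (1 + \<gamma>))" using tpos by (simp add: powr_mult_base)
    then show ?thesis by (simp only: e2 c_def mult_ac)
  qed
  finally have "g t \<le> c * t powr (- (1 + \<gamma>)) * cdf \<eta> t" using tpos by simp
  with gt have "g x \<le> c * t powr (- (1 + \<gamma>)) * cdf \<eta> t" by linarith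
  then show "\<exists>t. 0 < t \<and> t \<le> x \<and> g x \<le> 2 * (\<alpha> * (2 * (\<alpha> / (1 - \<beta>))) powr \<gamma>) * t powr (- (1 + \<gamma>)) * cdf \<eta> t"
    using tpos t by (auto simp: c_def B_def)
qed

section \<open>Logarithmic bounds for \<open>g\<close> and the limit\<close>

lemma eventually_le_powr:
  assumes "0 < a" "0 < q"
  shows "eventually (\<lambda>x. P \<le> (a / x) powr q) (at_right (0::real))"
proof -
  have "filterlim (\<lambda>x. (a / x) powr q) at_top (at_right 0)"
    using assms by real_asymp
  then show ?thesis by (simp add: filterlim_at_top)
qed

text \<open>The point t from \<open>g_le_cdf\<close> is unknown in (0, x], so all estimates must
  hold on a whole interval (0, x0). A fraction \<delta> of the exponent absorbs the power of t and
  the constants.\<close>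

lemma eventually_g_le:
  assumes \<delta>: "0 < \<delta>" "\<delta> < 1"
  shows "eventually (\<lambda>x. g x \<le> exp (- ((1 - \<delta>) * C0 * x powr (- \<gamma>)))) (at_right 0)"
proof -
  obtain c where c: "0 < c"
    "\<And>x. 0 < x \<Longrightarrow> 0 < g x \<Longrightarrow> \<exists>t. 0 < t \<and> t \<le> x \<and> g x \<le> c * t powr (- (1 + \<gamma>)) * cdf \<eta> t"
    using g_le_cdf by blast
  define c' where "c' = c * exp (A / \<beta> * lam powr \<beta>)"
  have c': "0 < c'" using c by (simp add: c'_def)
  define d where "d = \<delta> * C0"
  have d: "0 < d" using \<delta> C0_pos by (simp add: d_def)
  have "((\<lambda>t. c' * t powr (- (1 + \<gamma>)) * exp (- (d * t powr (- \<gamma>)))) \<longlongrightarrow> 0) (at_right 0)"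
    using c' d \<gamma>(1) by real_asymp
  then have "eventually (\<lambda>t. c' * t powr (- (1 + \<gamma>)) * exp (- (d * t powr (- \<gamma>))) < 1) (at_right 0)"
    by (rule order_tendstoD) simp
  moreover have "eventually (\<lambda>t. lam \<le> (A / t) powr (1 + \<gamma>)) (at_right 0)"
    using A_pos \<gamma>(1) by (intro eventually_le_powr) auto
  ultimately have "eventually (\<lambda>t. c' * t powr (- (1 + \<gamma>)) * exp (- (d * t powr (- \<gamma>))) < 1 \<and>
      lam \<le> (A / t) powr (1 + \<gamma>)) (at_right 0)"
    by (rule eventually_conj)
  then obtain x0 where x0: "0 < x0" "\<And>t. 0 < t \<Longrightarrow> t < x0 \<Longrightarrow>
      c' * t powr (- (1 + \<gamma>)) * exp (- (d * t powr (- \<gamma>))) < 1 \<and> lam \<le> (A / t) powr (1 + \<gamma>)"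
    unfolding eventually_at_right_field by auto
  have "g x \<le> exp (- ((1 - \<delta>) * C0 * x powr (- \<gamma>)))" if x: "0 < x" "x < x0" for x
  proof (cases "g x = 0")
    case False
    then have "0 < g x" using g_nonneg[of x] by linarith
    then obtain t where t: "0 < t" "t \<le> x" "g x \<le> c * t powr (- (1 + \<gamma>)) * cdf \<eta> t"
      using c(2) x by blast
    have t0: "c' * t powr (- (1 + \<gamma>)) * exp (- (d * t powr (- \<gamma>))) < 1" "lam \<le> (A / t) powr (1 + \<gamma>)"
      using x0(2)[of t] t x by auto
    have "c * t powr (- (1 + \<gamma>)) * cdf \<eta> t \<le> c * t powr (- (1 + \<gamma>)) *
        (exp (A / \<beta> * lam powr \<beta>) * exp (- (C0 * t powr (- \<gamma>))))"
      using c t t0 by (intro mult_left_mono cdf_upper) auto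
    also have "exp (- (C0 * t powr (- \<gamma>))) = exp (- (d * t powr (- \<gamma>))) * exp (- ((1 - \<delta>) * C0 * t powr (- \<gamma>)))"
      by (simp add: d_def exp_add[symmetric] algebra_simps)
    also have "c * t powr (- (1 + \<gamma>)) * (exp (A / \<beta> * lam powr \<beta>) * \<dots>) =
        (c' * t powr (- (1 + \<gamma>)) * exp (- (d * t powr (- \<gamma>)))) * exp (- ((1 - \<delta>) * C0 * t powr (- \<gamma>)))"
      by (simp add: c'_def mult_ac)
    also have "\<dots> \<le> 1 * exp (- ((1 - \<delta>) * C0 * t powr (- \<gamma>)))"
      using t0 by (intro mult_right_mono) auto
    \<comment> \<open>The remaining exponential increases in t, so t may be replaced by x.\<close>
    also have "\<dots> \<le> exp (- ((1 - \<delta>) * C0 * x powr (- \<gamma>)))"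
      using t \<gamma>(1) \<delta> C0_pos by (simp add: powr_mono2')
    finally show ?thesis using t by linarith
  qed simp
  then show ?thesis unfolding eventually_at_right_field using x0(1) by blast
qed

text \<open>Since k(x) / x tends to infinity, it eventually exceeds 1, and \<open>g_lower\<close>
  makes g at least the distribution function.\<close>

lemma eventually_g_ge:
  assumes \<epsilon>: "0 < \<epsilon>" "\<epsilon> < 1"
  shows "eventually (\<lambda>x. exp (- (D0 \<epsilon> * x powr (- \<gamma>) + lam * x + ln 2)) \<le> g x) (at_right 0)"
proof -
  define a where "a = (1 + \<epsilon>) * A"
  have a: "0 < a" using \<epsilon> A_pos by (simp add: a_def)
  define b where "b = (1 - \<beta>) / (A * \<epsilon>\<^sup>2)"
  have b: "0 < b" using \<epsilon> A_pos \<beta> by (simp add: b_def)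
  have "((\<lambda>x. b * ((a / x) powr (1 + \<gamma>)) powr (- \<beta>)) \<longlongrightarrow> 0) (at_right 0)"
    using a b \<gamma>(1) \<beta> by real_asymp
  then have "eventually (\<lambda>x. b * ((a / x) powr (1 + \<gamma>)) powr (- \<beta>) < 1 / 2) (at_right 0)"
    by (rule order_tendstoD) simp
  moreover have "eventually (\<lambda>x. lam \<le> (a / x) powr (1 + \<gamma>)) (at_right 0)"
    using a \<gamma>(1) by (intro eventually_le_powr) auto
  moreover have "filterlim (\<lambda>x. \<alpha> * (x powr (- \<beta>) * exp (- lam * x)) / x) at_top (at_right 0)"
    using \<alpha> \<beta> lam by real_asymp
  then have "eventually (\<lambda>x. 1 \<le> \<alpha> * (x powr (- \<beta>) * exp (- lam * x)) / x) (at_right 0)"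
    by (simp add: filterlim_at_top)
  moreover have "eventually (\<lambda>x. (0::real) < x) (at_right 0)"
    by (rule eventually_at_right_less)
  ultimately show ?thesis
  proof eventually_elim
    case (elim x)
    have "exp (- (D0 \<epsilon> * x powr (- \<gamma>) + lam * x + ln 2)) \<le> cdf \<eta> x"
      using elim \<epsilon> by (intro cdf_lower[OF _ _ _ refl]) (auto simp: a_def b_def)
    also have "\<dots> \<le> (k x / x) * cdf \<eta> x"
    proof -
      have "1 \<le> k x / x" using elim by (simp add: k_def)
      from mult_right_mono[OF this cdf_nonneg[of x]] show ?thesis by simp
    qed
    also have "\<dots> \<le> g x"
      using g_lower[of x] elim by (simp add: field_simps)
    finally show ?case .
  qed
qed

lemma ln_g_asymp: "((\<lambda>x. ln (g x) / (- (C0 * x powr (- \<gamma>)))) \<longlongrightarrow> 1) (at_right 0)"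
proof (rule order_tendstoI)
  have pos: "eventually (\<lambda>x. (0::real) < x) (at_right 0)"
    by (rule eventually_at_right_less)
  \<comment> \<open>Excludes the default value of \<open>ln\<close> at 0, for which the bounds on g
    would say nothing about \<open>ln (g x)\<close>.\<close>
  have g_pos: "eventually (\<lambda>x. 0 < g x) (at_right 0)"
  proof -
    have "eventually (\<lambda>x. exp (- (D0 (1 / 2) * x powr (- \<gamma>) + lam * x + ln 2)) \<le> g x) (at_right 0)"
      by (rule eventually_g_ge) auto
    then show ?thesis by eventually_elim (erule less_le_trans[OF exp_gt_zero])
  qed
  {
    fix a :: real assume a: "a < 1"
    define \<delta> where "\<delta> = min (1 / 2) ((1 - a) / 2)"
    have \<delta>: "0 < \<delta>" "\<delta> < 1" "a < 1 - \<delta>" using a by (auto simp: \<delta>_def min_def field_simps)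
    \<comment> \<open>The denominator is negative, so the upper bound on g bounds the quotient from
      below.\<close>
    show "eventually (\<lambda>x. a < ln (g x) / (- (C0 * x powr (- \<gamma>)))) (at_right 0)"
      using eventually_g_le[OF \<delta>(1,2)] pos g_pos
    proof eventually_elim
      case (elim x)
      define u where "u = C0 * x powr (- \<gamma>)"
      have u: "0 < u" using C0_pos elim by (simp add: u_def)
      have "ln (g x) \<le> ln (exp (- ((1 - \<delta>) * u)))"
        using elim by (subst ln_le_cancel_iff) (auto simp: u_def mult.assoc)
      then have "ln (g x) \<le> - ((1 - \<delta>) * u)" by simp
      moreover have "a * u < (1 - \<delta>) * u" using \<delta> u by simp
      ultimately show ?case using u by (simp add: u_def[symmetric] field_simps)
    qed
  }
  {
    fix a :: real assume a: "1 < a"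
    \<comment> \<open>Fixes the window width \<epsilon> before x tends to 0, with D0 \<epsilon>
      strictly below a C0.\<close>
    have "(D0 \<longlongrightarrow> D0 0) (at_right 0)"
      unfolding D0_def by (intro tendsto_intros) auto
    moreover have "D0 0 = C0" using \<beta> by (simp add: D0_def C0_def field_simps)
    ultimately have "eventually (\<lambda>\<epsilon>. D0 \<epsilon> < a * C0) (at_right 0)"
      using a C0_pos by (intro order_tendstoD) auto
    moreover have "eventually (\<lambda>\<epsilon>. \<epsilon> < 1) (at_right (0::real))"
      by (rule eventually_at_rightI[of 0 1]) auto
    ultimately have "eventually (\<lambda>\<epsilon>. 0 < \<epsilon> \<and> \<epsilon> < 1 \<and> D0 \<epsilon> < a * C0) (at_right 0)"
      using pos by eventually_elim simp
    then obtain \<epsilon> where \<epsilon>: "0 < \<epsilon>" "\<epsilon> < 1" "D0 \<epsilon> < a * C0"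
      using eventually_happens[of _ "at_right (0::real)"] by (auto simp: trivial_limit_at_right_real)
    define e where "e = a * C0 - D0 \<epsilon>"
    have e: "0 < e" using \<epsilon> by (simp add: e_def)
    \<comment> \<open>The gap e multiplies a diverging power of x and so outgrows the error lam x +
      ln 2.\<close>
    have "filterlim (\<lambda>x. e * x powr (- \<gamma>) - lam * x) at_top (at_right 0)"
      using e lam \<gamma>(1) by real_asymp
    then have "eventually (\<lambda>x. ln 2 < e * x powr (- \<gamma>) - lam * x) (at_right 0)"
      by (simp add: filterlim_at_top_dense)
    then show "eventually (\<lambda>x. ln (g x) / (- (C0 * x powr (- \<gamma>))) < a) (at_right 0)"
      using eventually_g_ge[OF \<epsilon>(1,2)] pos g_pos
    proof eventually_elim
      case (elim x)
      define u where "u = C0 * x powr (- \<gamma>)"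
      have u: "0 < u" using C0_pos elim by (simp add: u_def)
      have "- (D0 \<epsilon> * x powr (- \<gamma>) + lam * x + ln 2) \<le> ln (g x)"
        using elim by (simp add: ln_ge_iff)
      moreover have "a * u = D0 \<epsilon> * x powr (- \<gamma>) + e * x powr (- \<gamma>)"
        by (simp add: u_def e_def algebra_simps)
      ultimately have "- ln (g x) < a * u" using elim by linarith
      then show ?case using u by (simp add: u_def[symmetric] field_simps)
    qed
  }
qed

text \<open>Continuity together with g(0) = 0 suffices.\<close>

lemma g_tendsto_0: "(g \<longlongrightarrow> 0) (at_right 0)"
proof -
  have "(g \<longlongrightarrow> g 0) (at_right 0)"
    using g_continuous[of UNIV] by (auto simp: continuous_on_def intro: tendsto_within_subset)
  then show ?thesis by (simp add: g_eq_0)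
qed

end

theorem proposition7p2:
  fixes \<alpha> \<beta> lam :: real and \<eta> :: "real measure" and g :: "real \<Rightarrow> real"
  assumes "0 < \<alpha>" and "0 < lam" and "0 < \<beta>" and "\<beta> < 1"
    and "is_TS \<alpha> \<beta> lam \<eta>"
    and "is_continuous_density \<eta> g"
  shows "(\<lambda>x. ln (g x)) \<sim>[at_right 0]
           (\<lambda>x. - ((1 - \<beta>) / \<beta> * (\<alpha> * Gamma (1 - \<beta>)) powr (1 / (1 - \<beta>)) *
                    x powr (- (\<beta> / (1 - \<beta>)))))
         \<and> (g \<longlongrightarrow> 0) (at_right 0)"
proof -
  interpret TS_density \<alpha> \<beta> lam \<eta> g using assms by unfold_locales
  have "(\<lambda>x. ln (g x)) \<sim>[at_right 0] (\<lambda>x. - (C0 * x powr (- \<gamma>)))"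
    by (rule asymp_equivI'[OF ln_g_asymp])
  then show ?thesis
    using g_tendsto_0 by (simp only: C0_def A_def \<gamma>(2)[symmetric] \<gamma>_def[symmetric])
qed

end
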